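(* Let $(L_n^\varepsilon)_{n\in\mathbb Z}$, for $\varepsilon$ in a neighbourhood of $0$, be Markov operators on Banach spaces $(B_s,\|\cdot\|_s)\subset(B_w,\|\cdot\|_w)$, write $L_n:=L_n^0$, and let $(\pi_m)_{m\ge1}$ be projections on $B_w$. Put $M_n^\varepsilon:=\pi_mL_n^\varepsilon\pi_m$ and $M_n:=M_n^0$ (both depending on $m$). Let $\boldsymbol h=(h_n)_{n\in\mathbb Z}$ be the equivariant family of $(L_n)_{n\in\mathbb Z}$ and, for each $m$, let $\boldsymbol h^m=(h_n^m)_{n\in\mathbb Z}$ be an equivariant family of $(M_n)_{n\in\mathbb Z}$. Assume: (a) there are $C_0\ge1,\gamma>0$ with $\|L_{j+k-1}\circ\cdots\circ L_jv\|_s\le C_0e^{-\gamma k}\|v\|_s$ for all $j\in\mathbb Z,k\ge1,v\in V_s$; (b) each $\pi_m$ preserves total mass, $\|\pi_mf\|_w\le\|f\|_w$ for $f\in B_w$, $\|\pi_mf\|_s\le\|f\|_s$ for $f\in B_s$, and $\|\pi_mf-f\|_w\le\delta_m\|f\|_s$ for $f\in B_s$, with $\delta_m\to0$; (c) $\|L_nf\|_w\le\|f\|_w$ for all $n$ and $f\in B_w$, and there are $B\ge1$, $\lambda_1\in[0,1)$ with $\|L_nf\|_s\le\lambda_1\|f\|_s+B\|f\|_w$ and $\|M_nf\|_s\le\lambda_1\|f\|_s+B\|f\|_w$ for all $n,m$ and $f\in B_s$; (d) for each $n\in\mathbb Z$, $m\in\mathbb N$ the limits $$\psi_n:=\lim_{\varepsilon\to0}\frac{L_{n-1}^\varepsilon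 h_{n-1}-L_{n-1}h_{n-1}}{\varepsilon},\qquad \psi_n^m:=\lim_{\varepsilon\to0}\frac{M_{n-1}^\varepsilon h_{n-1}^m-M_{n-1}h_{n-1}^m}{\varepsilon}$$ exist in $B_s$, with $\sup_n\|\psi_n\|_s<\infty$ and $\sup_n\|\psi_n^m\|_s<\infty$; (e) for each $n$ there is a bounded linear $\dot L_n:B_w\to B_w$ with $\|L_n^\varepsilon-L_n-\varepsilon\dot L_n\|_{B_w\to B_w}=o(\varepsilon)$ as $\varepsilon\to0$, and $\sup_n\|\dot L_n\|_{B_w\to B_w}<\infty$; (f) there is $C_{\mathrm{reg}}>0$ with $L_nf\in B_s$ and $\|L_nf\|_s\le C_{\mathrm{reg}}\|f\|_w$ for all $n\in\mathbb Z$ and $f\in B_w$. Let $\boldsymbol\psi:=(\psi_n)_{n\in\mathbb Z}$, $\boldsymbol\psi^m:=(\psi^m_n)_{n\in\mathbb Z}$ and, for all sufficiently large $m$, $$\hat{\boldsymbol h}:=(I-\mathbb F)^{-1}\boldsymbol\psi,\qquad \hat{\boldsymbol h}^m:=(I-\mathbb F_m)^{-1}\boldsymbol\psi^m .$$ Then $$\|\hat{\boldsymbol h}^m-\Pi_m\hat{\boldsymbol h}\|_{\mathcal B_w}\to0\qquad\text{as }m\to\infty .$$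
   Context: $(X,\mathcal A)$ is a measurable space; $B_s\subset B_w$ are spaces of finite signed measures on $X$ with $\|\mu\|_w\le\|\mu\|_s$ for $\mu\in B_s$. $V_s:=\{\mu\in B_s:\mu(X)=0\}$, $V_w:=\{\mu\in B_w:\mu(X)=0\}$, $\mathcal P_s:=\{\mu\in B_s:\mu\ge0,\mu(X)=1\}$. A Markov operator is a linear map $B_w\to B_w$ that maps $B_s$ into $B_s$, preserves positivity and preserves total mass $\mu\mapsto\mu(X)$. A projection is a linear map $\pi$ with $\pi^2=\pi$; $\pi_m$ maps $B_s$ into $B_s$. An equivariant family of $(A_n)_{n\in\mathbb Z}$ is a sequence $(\mu_n)\in\mathcal P_s^{\mathbb Z}$ with $\sup_n\|\mu_n\|_s<\infty$ and $\mu_{n+1}=A_n\mu_n$ for all $n$. Sequence spaces: $\mathcal B_s:=\ell^\infty(\mathbb Z;B_s)$, $\mathcal B_w:=\ell^\infty(\mathbb Z;B_w)$ with norms $\|\boldsymbol\mu\|_{\mathcal B_s}:=\sup_n\|\mu_n\|_s$, $\|\boldsymbol\mu\|_{\mathcal B_w}:=\sup_n\|\mu_n\|_w$; $\mathcal V_s:=\ell^\infty(\mathbb Z;V_s)$ and $\mathcal V_w:=\ell^\infty(\mathbb Z;V_w)$ are the zero-mass sequence spaces. Global operators: $(\mathbb F\boldsymbol\mu)_n:=L_{n-1}\mu_{n-1}$, $(\mathbb F_m\boldsymbol\mu)_n:=M_{n-1}\mu_{n-1}$, $(\Pi_m\boldsymbol\mu)_n:=\pi_m\mu_n$. The inverses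 $(I-\mathbb F)^{-1}$ and $(I-\mathbb F_m)^{-1}$ are the inverses on the zero-mass space $\mathcal V_w$, given there by the Neumann series $\sum_{k\ge0}\mathbb F^k$ and $\sum_{k\ge0}\mathbb F_m^k$; for $\mathbb F_m$ they exist for all sufficiently large $m$. *)

theory Defs
  imports "HOL-Analysis.Analysis" "HOL-Library.Function_Algebras" "HOL-Library.Landau_Symbols"
begin

text \<open>
  Real-valued set functions form the ambient real vector space, with pointwise operations
  (addition comes from \<^theory>\<open>HOL-Library.Function_Algebras\<close>).
\<close>

instantiation "fun" :: (type, real_vector) real_vector
begin

definition scaleR_fun :: "real \<Rightarrow> ('a \<Rightarrow> 'b) \<Rightarrow> 'a \<Rightarrow> 'b" where
  "scaleR_fun c f = (\<lambda>x. c *\<^sub>R f x)"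

instance
  by standard (auto simp: scaleR_fun_def fun_eq_iff scaleR_add_right scaleR_add_left)

end

lemma scaleR_fun_apply [simp]: "(c *\<^sub>R f) x = c *\<^sub>R f x"
  by (simp add: scaleR_fun_def)

text \<open>
  A set function is required to vanish off the sigma-algebra, so that equality of set functions
  is equality of signed measures. Convergence for every enumeration of the (disjoint) sets makes
  the series absolutely convergent, and it forces the value \<open>0\<close> on the empty set.
\<close>

definition finite_signed_measure :: "'a measure \<Rightarrow> ('a set \<Rightarrow> real) \<Rightarrow> bool" where
  "finite_signed_measure M \<mu> \<longleftrightarrow>
     (\<forall>A. A \<notin> sets M \<longrightarrow> \<mu> A = 0) \<and>
     (\<forall>A :: nat \<Rightarrow> 'a set. range A \<subseteq> sets M \<longrightarrow> disjoint_family A \<longrightarrow>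
        (\<lambda>i. \<mu> (A i)) sums \<mu> (\<Union>i. A i))"

definition nonneg_on :: "'a measure \<Rightarrow> ('a set \<Rightarrow> real) \<Rightarrow> bool" where
  "nonneg_on M \<mu> \<longleftrightarrow> (\<forall>A\<in>sets M. 0 \<le> \<mu> A)"

definition zero_mass :: "'a measure \<Rightarrow> ('a set \<Rightarrow> real) set \<Rightarrow> ('a set \<Rightarrow> real) set" where
  "zero_mass M B = {\<mu> \<in> B. \<mu> (space M) = 0}"

definition prob_measures :: "'a measure \<Rightarrow> ('a set \<Rightarrow> real) set \<Rightarrow> ('a set \<Rightarrow> real) set" where
  "prob_measures M B = {\<mu> \<in> B. nonneg_on M \<mu> \<and> \<mu> (space M) = 1}"


text \<open>
  Norms are functions that are only meaningful on their carrier. The distance is set to \<open>0\<close> off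
  the carrier because \<^locale>\<open>Metric_space\<close> asks for symmetry and nonnegativity on the whole type.
\<close>

definition norm_dist :: "'v::real_vector set \<Rightarrow> ('v \<Rightarrow> real) \<Rightarrow> 'v \<Rightarrow> 'v \<Rightarrow> real" where
  "norm_dist B N x y = (if x \<in> B \<and> y \<in> B then N (x - y) else 0)"

abbreviation norm_topology :: "'v::real_vector set \<Rightarrow> ('v \<Rightarrow> real) \<Rightarrow> 'v topology" where
  "norm_topology B N \<equiv> Metric_space.mtopology B (norm_dist B N)"

locale normed_on =
  fixes B :: "'v::real_vector set" and N :: "'v \<Rightarrow> real"
  assumes subspace: "subspace B"
    and norm_eq_zero: "x \<in> B \<Longrightarrow> N x = 0 \<longleftrightarrow> x = 0"
    and norm_scale: "x \<in> B \<Longrightarrow> N (c *\<^sub>R x) = \<bar>c\<bar> * N x"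
    and norm_triangle: "x \<in> B \<Longrightarrow> y \<in> B \<Longrightarrow> N (x + y) \<le> N x + N y"
begin

lemma norm_nonneg: "x \<in> B \<Longrightarrow> 0 \<le> N x"
proof -
  assume x: "x \<in> B"
  then have mx: "(- 1) *\<^sub>R x \<in> B"
    using subspace subspace_scale by blast
  have "N (x + (- 1) *\<^sub>R x) \<le> N x + N ((- 1) *\<^sub>R x)"
    using norm_triangle[OF x mx] .
  moreover have "N ((- 1) *\<^sub>R x) = N x"
    using norm_scale[OF x, of "- 1"] by simp
  moreover have "N (x + (- 1) *\<^sub>R x) = 0"
    using norm_eq_zero[of 0] subspace subspace_0 by fastforce
  ultimately show ?thesis by simp
qed

lemma Metric_space_norm_dist: "Metric_space B (norm_dist B N)"
proof
  fix x y
  show "0 \<le> norm_dist B N x y"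
    using norm_nonneg subspace subspace_diff by (auto simp: norm_dist_def)
  have "N (x - y) = N (y - x)" if "x \<in> B" "y \<in> B"
    using norm_scale[of "y - x" "- 1"] subspace_diff[OF subspace] that by simp
  then show "norm_dist B N x y = norm_dist B N y x"
    by (auto simp: norm_dist_def)
next
  fix x y assume "x \<in> B" "y \<in> B"
  then show "norm_dist B N x y = 0 \<longleftrightarrow> x = y"
    using norm_eq_zero[of "x - y"] subspace_diff[OF subspace] by (simp add: norm_dist_def)
next
  fix x y z assume "x \<in> B" "y \<in> B" "z \<in> B"
  then show "norm_dist B N x z \<le> norm_dist B N x y + norm_dist B N y z"
    using norm_triangle[of "x - y" "y - z"] subspace_diff[OF subspace]
    by (simp add: norm_dist_def)
qed

end

locale banach_on = normed_on +
  assumes complete: "Metric_space.mcomplete B (norm_dist B N)"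


definition linear_on :: "'v::real_vector set \<Rightarrow> ('v \<Rightarrow> 'v) \<Rightarrow> bool" where
  "linear_on B T \<longleftrightarrow> T ` B \<subseteq> B \<and>
     (\<forall>x\<in>B. \<forall>y\<in>B. T (x + y) = T x + T y) \<and> (\<forall>c. \<forall>x\<in>B. T (c *\<^sub>R x) = c *\<^sub>R T x)"

definition bounded_linear_on :: "'v::real_vector set \<Rightarrow> ('v \<Rightarrow> real) \<Rightarrow> ('v \<Rightarrow> 'v) \<Rightarrow> bool" where
  "bounded_linear_on B N T \<longleftrightarrow> linear_on B T \<and> (\<exists>K. \<forall>x\<in>B. N (T x) \<le> K * N x)"

text \<open>As for \<^const>\<open>onorm\<close>, the value is meaningful for bounded operators only.\<close>

definition onorm_on :: "'v::real_vector set \<Rightarrow> ('v \<Rightarrow> real) \<Rightarrow> ('v \<Rightarrow> 'v) \<Rightarrow> real" where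
  "onorm_on B N T = (SUP x\<in>B. N (T x) / N x)"

definition preserves_mass ::
    "'a measure \<Rightarrow> ('a set \<Rightarrow> real) set \<Rightarrow> (('a set \<Rightarrow> real) \<Rightarrow> ('a set \<Rightarrow> real)) \<Rightarrow> bool" where
  "preserves_mass M B T \<longleftrightarrow> (\<forall>\<mu>\<in>B. T \<mu> (space M) = \<mu> (space M))"

definition markov_operator ::
    "'a measure \<Rightarrow> ('a set \<Rightarrow> real) set \<Rightarrow> ('a set \<Rightarrow> real) set \<Rightarrow>
      (('a set \<Rightarrow> real) \<Rightarrow> ('a set \<Rightarrow> real)) \<Rightarrow> bool" where
  "markov_operator M Bs Bw T \<longleftrightarrow>
     linear_on Bw T \<and> T ` Bs \<subseteq> Bs \<and>
     (\<forall>\<mu>\<in>Bw. nonneg_on M \<mu> \<longrightarrow> nonneg_on M (T \<mu>)) \<and>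
     preserves_mass M Bw T"

definition projection_on :: "'v::real_vector set \<Rightarrow> ('v \<Rightarrow> 'v) \<Rightarrow> bool" where
  "projection_on B p \<longleftrightarrow> linear_on B p \<and> (\<forall>x\<in>B. p (p x) = p x)"

definition compress :: "('v \<Rightarrow> 'v) \<Rightarrow> ('v \<Rightarrow> 'v) \<Rightarrow> 'v \<Rightarrow> 'v" where
  "compress p T = p \<circ> T \<circ> p"

text \<open>\<open>cocycle T j k\<close> is \<open>T (j + k - 1) \<circ> \<dots> \<circ> T j\<close>.\<close>

primrec cocycle :: "(int \<Rightarrow> 'v \<Rightarrow> 'v) \<Rightarrow> int \<Rightarrow> nat \<Rightarrow> 'v \<Rightarrow> 'v" where
  "cocycle T j 0 = id"
| "cocycle T j (Suc k) = T (j + int k) \<circ> cocycle T j k"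


definition ell_infty :: "'v set \<Rightarrow> ('v \<Rightarrow> real) \<Rightarrow> (int \<Rightarrow> 'v) set" where
  "ell_infty V N = {\<mu>. (\<forall>n. \<mu> n \<in> V) \<and> bdd_above (range (\<lambda>n. N (\<mu> n)))}"

definition sup_norm :: "('v \<Rightarrow> real) \<Rightarrow> (int \<Rightarrow> 'v) \<Rightarrow> real" where
  "sup_norm N \<mu> = (SUP n. N (\<mu> n))"

definition equivariant_family ::
    "'a measure \<Rightarrow> ('a set \<Rightarrow> real) set \<Rightarrow> (('a set \<Rightarrow> real) \<Rightarrow> real) \<Rightarrow>
      (int \<Rightarrow> ('a set \<Rightarrow> real) \<Rightarrow> ('a set \<Rightarrow> real)) \<Rightarrow> (int \<Rightarrow> 'a set \<Rightarrow> real) \<Rightarrow> bool" where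
  "equivariant_family M B N T \<mu> \<longleftrightarrow>
     (\<forall>n. \<mu> n \<in> prob_measures M B) \<and> bdd_above (range (\<lambda>n. N (\<mu> n))) \<and>
     (\<forall>n. \<mu> (n + 1) = T n (\<mu> n))"

definition global_op :: "(int \<Rightarrow> 'v \<Rightarrow> 'v) \<Rightarrow> (int \<Rightarrow> 'v) \<Rightarrow> int \<Rightarrow> 'v" where
  "global_op T \<mu> = (\<lambda>n. T (n - 1) (\<mu> (n - 1)))"

definition global_proj :: "('v \<Rightarrow> 'v) \<Rightarrow> (int \<Rightarrow> 'v) \<Rightarrow> int \<Rightarrow> 'v" where
  "global_proj p \<mu> = (\<lambda>n. p (\<mu> n))"

text \<open>The inverse of \<open>I - T\<close> on \<open>V\<close>; it is meaningful when \<open>I - T\<close> maps \<open>V\<close> bijectively onto \<open>V\<close>.\<close>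

definition inverse_id_minus :: "'v::ab_group_add set \<Rightarrow> ('v \<Rightarrow> 'v) \<Rightarrow> 'v \<Rightarrow> 'v" where
  "inverse_id_minus V T = the_inv_into V (\<lambda>x. x - T x)"

definition neumann_invertible ::
    "'v::ab_group_add set \<Rightarrow> ('v \<Rightarrow> real) \<Rightarrow> ('v \<Rightarrow> 'v) \<Rightarrow> bool" where
  "neumann_invertible V N T \<longleftrightarrow>
     bij_betw (\<lambda>x. x - T x) V V \<and>
     (\<forall>x\<in>V. (\<lambda>K. N (inverse_id_minus V T x - (\<Sum>k<K. (T ^^ k) x))) \<longlonglongrightarrow> 0)"

end

theory Submission
  imports Defs "HOL-Real_Asymp.Real_Asymp"
begin

text \<open>
  Regularization turns the strong loss of memory into a weak one on zero-mass measures, and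
  telescoping shows that a fixed power of \<open>F\<^sub>m\<close> halves the weak norm once \<open>\<delta>\<^sub>m\<close> is small. Hence
  \<open>I - F\<^sub>m\<close> is invertible with a bound on the inverse that is uniform in \<open>m\<close>. Applied to
  \<open>(I - F\<^sub>m) (h\<^sup>m - h) = (F\<^sub>m - F) h\<close>, the bound gives \<open>h\<^sup>m \<longrightarrow> h\<close> weakly, and therefore
  \<open>\<psi>\<^sup>m - \<Pi>\<^sub>m \<psi> \<longrightarrow> 0\<close>, since \<open>\<psi>\<close> and \<open>\<psi>\<^sup>m\<close> are the images of \<open>h\<close> and \<open>h\<^sup>m\<close> under \<open>Ldot\<close> and
  \<open>\<pi>\<^sub>m \<circ> Ldot\<close>. Write \<open>z\<close> and \<open>z\<^sup>m\<close> for the two responses; the conclusion follows from the same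
  bound and \<open>(I - F\<^sub>m) (z\<^sup>m - \<Pi>\<^sub>m z) = (\<psi>\<^sup>m - \<Pi>\<^sub>m \<psi>) + \<Pi>\<^sub>m F (\<Pi>\<^sub>m z - z)\<close>.
\<close>

subsection \<open>Contracting operators on Banach spaces of bounded sequences\<close>

context normed_on
begin

interpretation metric: Metric_space B "norm_dist B N"
  by (rule Metric_space_norm_dist)

lemma add_closed: "x \<in> B \<Longrightarrow> y \<in> B \<Longrightarrow> x + y \<in> B"
  and diff_closed: "x \<in> B \<Longrightarrow> y \<in> B \<Longrightarrow> x - y \<in> B"
  and scale_closed: "x \<in> B \<Longrightarrow> c *\<^sub>R x \<in> B"
  and zero_closed: "0 \<in> B"
  using subspace by (simp_all add: subspace_add subspace_diff subspace_scale subspace_0)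

lemma norm_zero: "N 0 = 0"
  using norm_eq_zero zero_closed by blast

lemma norm_minus_commute: "x \<in> B \<Longrightarrow> y \<in> B \<Longrightarrow> N (x - y) = N (y - x)"
  using norm_scale[of "y - x" "- 1"] by (simp add: diff_closed)

lemma norm_triangle_diff: "x \<in> B \<Longrightarrow> y \<in> B \<Longrightarrow> N x \<le> N y + N (x - y)"
  using norm_triangle[of y "x - y"] by (simp add: diff_closed)

lemma norm_diff_le: "x \<in> B \<Longrightarrow> y \<in> B \<Longrightarrow> N (x - y) \<le> N x + N y"
  using norm_triangle_diff[of "x - y" x] norm_minus_commute[of "x - y" x] norm_scale[of y "- 1"]
  by (simp add: diff_closed)

text \<open>\<open>norm_dist\<close> is 0 off the carrier, so a vanishing distance says nothing
  about points outside \<open>B\<close>. Eventual membership closes this gap: along such a filter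
  distance and norm agree.\<close>

lemma limitin_norm:
  "limitin (norm_topology B N) f l F \<longleftrightarrow>
     l \<in> B \<and> (\<forall>\<^sub>F x in F. f x \<in> B) \<and> ((\<lambda>x. N (f x - l)) \<longlongrightarrow> 0) F"
proof -
  have "(\<forall>\<^sub>F x in F. f x \<in> B) \<Longrightarrow> l \<in> B \<Longrightarrow>
      ((\<lambda>x. norm_dist B N (f x) l) \<longlongrightarrow> 0) F \<longleftrightarrow> ((\<lambda>x. N (f x - l)) \<longlongrightarrow> 0) F"
    by (rule tendsto_cong) (auto simp: norm_dist_def elim: eventually_mono)
  then show ?thesis
    by (auto simp: metric.limitin_metric_dist_null)
qed

lemma MCauchy_norm:
  "metric.MCauchy \<sigma> \<longleftrightarrow>
     (\<forall>i. \<sigma> i \<in> B) \<and> (\<forall>e>0. \<exists>k. \<forall>m\<ge>k. \<forall>n\<ge>k. N (\<sigma> m - \<sigma> n) < e)"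
  by (auto simp: metric.MCauchy_def norm_dist_def image_subset_iff)

lemma norm_le_sup_norm: "\<mu> \<in> ell_infty B N \<Longrightarrow> N (\<mu> n) \<le> sup_norm N \<mu>"
  by (auto simp: ell_infty_def sup_norm_def intro: cSUP_upper)

lemma sup_norm_le: "(\<And>n. N (\<mu> n) \<le> c) \<Longrightarrow> sup_norm N \<mu> \<le> c"
  by (simp add: sup_norm_def cSUP_least)

lemma ell_inftyI: "(\<And>n. \<mu> n \<in> B) \<Longrightarrow> (\<And>n. N (\<mu> n) \<le> c) \<Longrightarrow> \<mu> \<in> ell_infty B N"
  by (fastforce simp: ell_infty_def bdd_above_def)

lemma ell_inftyD: "\<mu> \<in> ell_infty B N \<Longrightarrow> \<mu> n \<in> B"
  by (simp add: ell_infty_def)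

lemma sup_norm_nonneg: "\<mu> \<in> ell_infty B N \<Longrightarrow> 0 \<le> sup_norm N \<mu>"
  by (meson ell_inftyD norm_le_sup_norm norm_nonneg order_trans)

lemma normed_on_ell_infty: "normed_on (ell_infty B N) (sup_norm N)"
proof
  have add: "x + y \<in> ell_infty B N" and triangle: "sup_norm N (x + y) \<le> sup_norm N x + sup_norm N y"
    if x: "x \<in> ell_infty B N" and y: "y \<in> ell_infty B N" for x y
  proof -
    have le: "N ((x + y) n) \<le> sup_norm N x + sup_norm N y" for n
      using norm_triangle[OF ell_inftyD[OF x, of n] ell_inftyD[OF y, of n]]
        norm_le_sup_norm[OF x, of n] norm_le_sup_norm[OF y, of n] by simp
    show "x + y \<in> ell_infty B N"
      using le by (rule ell_inftyI[rotated]) (use x y in \<open>simp add: ell_inftyD add_closed\<close>)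
    show "sup_norm N (x + y) \<le> sup_norm N x + sup_norm N y"
      using le by (rule sup_norm_le)
  qed
  have scale: "c *\<^sub>R x \<in> ell_infty B N" and le: "sup_norm N (c *\<^sub>R x) \<le> \<bar>c\<bar> * sup_norm N x"
    if x: "x \<in> ell_infty B N" for c x
  proof -
    have le: "N ((c *\<^sub>R x) n) \<le> \<bar>c\<bar> * sup_norm N x" for n
      using norm_scale[OF ell_inftyD[OF x, of n]] norm_le_sup_norm[OF x, of n]
      by (simp add: mult_left_mono)
    show "c *\<^sub>R x \<in> ell_infty B N"
      using le by (rule ell_inftyI[rotated]) (use x in \<open>simp add: ell_inftyD scale_closed\<close>)
    show "sup_norm N (c *\<^sub>R x) \<le> \<bar>c\<bar> * sup_norm N x"
      using le by (rule sup_norm_le)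
  qed
  have zero: "0 \<in> ell_infty B N"
    by (rule ell_inftyI[where c = 0]) (simp_all add: zero_closed norm_zero)
  show "subspace (ell_infty B N)"
    by (rule subspaceI) (use add scale zero in blast)+
  show "sup_norm N (x + y) \<le> sup_norm N x + sup_norm N y"
    if "x \<in> ell_infty B N" "y \<in> ell_infty B N" for x y
    using that by (rule triangle)
  show "sup_norm N x = 0 \<longleftrightarrow> x = 0" if x: "x \<in> ell_infty B N" for x
  proof
    assume "sup_norm N x = 0"
    then have "N (x n) = 0" for n
      using norm_le_sup_norm[OF x, of n] norm_nonneg[OF ell_inftyD[OF x, of n]] by simp
    then show "x = 0"
      by (simp add: fun_eq_iff norm_eq_zero ell_inftyD[OF x])
  qed (simp add: sup_norm_def norm_zero)
  show "sup_norm N (c *\<^sub>R x) = \<bar>c\<bar> * sup_norm N x" if x: "x \<in> ell_infty B N" for c x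
  proof (cases "c = 0")
    case True
    then show ?thesis by (simp add: sup_norm_def norm_zero)
  next
    case False
    \<comment> \<open>Scaling back by \<open>inverse c\<close> turns the upper bound
      \<open>le\<close> into the reverse inequality.\<close>
    then have "\<bar>c\<bar> * sup_norm N x \<le> sup_norm N (c *\<^sub>R x)"
      using le[OF scale[OF x, of c], of "inverse c"]
      by (simp add: field_simps abs_inverse)
    then show ?thesis using le[OF x, of c] by simp
  qed
qed

lemma normed_on_subset: "subspace A \<Longrightarrow> A \<subseteq> B \<Longrightarrow> normed_on A N"
  by unfold_locales (simp_all add: subset_iff norm_eq_zero norm_scale norm_triangle)

end

lemma (in normed_on) banach_onI:
  assumes "\<And>\<sigma>. (\<And>i. \<sigma> i \<in> B) \<Longrightarrow> (\<forall>e>0. \<exists>k. \<forall>m\<ge>k. \<forall>n\<ge>k. N (\<sigma> m - \<sigma> n) < e) \<Longrightarrow>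
            \<exists>l\<in>B. (\<lambda>i. N (\<sigma> i - l)) \<longlonglongrightarrow> 0"
  shows "banach_on B N"
proof
  interpret metric: Metric_space B "norm_dist B N"
    by (rule Metric_space_norm_dist)
  show "metric.mcomplete"
    unfolding metric.mcomplete_def
  proof (intro allI impI)
    fix \<sigma> assume "metric.MCauchy \<sigma>"
    then have "\<And>i. \<sigma> i \<in> B" "\<forall>e>0. \<exists>k. \<forall>m\<ge>k. \<forall>n\<ge>k. N (\<sigma> m - \<sigma> n) < e"
      by (auto simp: MCauchy_norm)
    with assms[of \<sigma>] show "\<exists>l. limitin metric.mtopology \<sigma> l sequentially"
      by (auto simp: limitin_norm)
  qed
qed

section \<open>Completeness of the sequence spaces and of closed subspaces\<close>

context banach_on
begin

lemma Cauchy_converges: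
  assumes "\<And>i. \<sigma> i \<in> B" and "\<forall>e>0. \<exists>k. \<forall>m\<ge>k. \<forall>n\<ge>k. N (\<sigma> m - \<sigma> n) < e"
  obtains l where "l \<in> B" and "(\<lambda>i. N (\<sigma> i - l)) \<longlonglongrightarrow> 0"
proof -
  interpret metric: Metric_space B "norm_dist B N"
    by (rule Metric_space_norm_dist)
  have "metric.MCauchy \<sigma>"
    using assms by (simp add: MCauchy_norm)
  then obtain l where "limitin metric.mtopology \<sigma> l sequentially"
    using complete by (auto simp: metric.mcomplete_def)
  then have "l \<in> B" "(\<lambda>i. N (\<sigma> i - l)) \<longlonglongrightarrow> 0"
    by (simp_all add: limitin_norm)
  then show thesis by (rule that)
qed

lemma banach_on_closed_subspace:
  assumes A: "subspace A" "A \<subseteq> B"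
    and closed: "\<And>\<sigma> l. (\<And>i. \<sigma> i \<in> A) \<Longrightarrow> l \<in> B \<Longrightarrow> (\<lambda>i. N (\<sigma> i - l)) \<longlonglongrightarrow> 0 \<Longrightarrow> l \<in> A"
  shows "banach_on A N"
proof -
  interpret A: normed_on A N
    using A by (rule normed_on_subset)
  show ?thesis
  proof (rule A.banach_onI)
    fix \<sigma> :: "nat \<Rightarrow> 'a"
    assume \<sigma>: "\<And>i. \<sigma> i \<in> A" "\<forall>e>0. \<exists>k. \<forall>m\<ge>k. \<forall>n\<ge>k. N (\<sigma> m - \<sigma> n) < e"
    then obtain l where "l \<in> B" "(\<lambda>i. N (\<sigma> i - l)) \<longlonglongrightarrow> 0"
      using Cauchy_converges[of \<sigma>] A by blast
    with closed \<sigma> show "\<exists>l\<in>A. (\<lambda>i. N (\<sigma> i - l)) \<longlonglongrightarrow> 0" by blast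
  qed
qed

text \<open>Pointwise limits exist because \<open>B\<close> is complete. The Cauchy index comes from
  the sup norm and hence serves every coordinate, which makes the convergence uniform and the limit
  bounded.\<close>

lemma banach_on_ell_infty: "banach_on (ell_infty B N) (sup_norm N)"
proof -
  interpret ell: normed_on "ell_infty B N" "sup_norm N"
    by (rule normed_on_ell_infty)
  show ?thesis
  proof (rule ell.banach_onI)
    fix \<sigma> :: "nat \<Rightarrow> int \<Rightarrow> 'a"
    assume \<sigma>: "\<And>i. \<sigma> i \<in> ell_infty B N"
      and Cauchy: "\<forall>e>0. \<exists>k. \<forall>m\<ge>k. \<forall>n\<ge>k. sup_norm N (\<sigma> m - \<sigma> n) < e"
    have \<sigma>_in: "\<sigma> i n \<in> B" for i n
      using \<sigma> ell_inftyD by blast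
    have le: "N (\<sigma> i n - \<sigma> j n) \<le> sup_norm N (\<sigma> i - \<sigma> j)" for i j n
      using norm_le_sup_norm[OF ell.diff_closed[OF \<sigma>[of i] \<sigma>[of j]], of n] by simp
    have "\<exists>l. l \<in> B \<and> (\<lambda>i. N (\<sigma> i n - l)) \<longlonglongrightarrow> 0" for n
    proof -
      have "\<exists>k. \<forall>i\<ge>k. \<forall>j\<ge>k. N (\<sigma> i n - \<sigma> j n) < e" if e: "0 < e" for e
      proof -
        obtain k where k: "\<And>i j. k \<le> i \<Longrightarrow> k \<le> j \<Longrightarrow> sup_norm N (\<sigma> i - \<sigma> j) < e"
          using Cauchy e by blast
        then show ?thesis
          using order_le_less_trans[OF le k] by (intro exI[of _ k]) blast
      qed
      then show ?thesis
        using Cauchy_converges[of "\<lambda>i. \<sigma> i n"] \<sigma>_in by metis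
    qed
    then obtain l where l: "\<And>n. l n \<in> B" "\<And>n. (\<lambda>i. N (\<sigma> i n - l n)) \<longlonglongrightarrow> 0"
      by metis
    have uniform: "\<exists>k. \<forall>i\<ge>k. \<forall>n. N (\<sigma> i n - l n) \<le> e" if "0 < e" for e
    proof -
      obtain k where k: "\<And>i j. k \<le> i \<Longrightarrow> k \<le> j \<Longrightarrow> sup_norm N (\<sigma> i - \<sigma> j) < e"
        using Cauchy \<open>0 < e\<close> by blast
      have "N (\<sigma> i n - l n) \<le> e" if "k \<le> i" for i n
      proof (rule tendsto_lowerbound)
        \<comment> \<open>With \<open>i\<close> and \<open>n\<close> fixed, \<open>j\<close> tends
          to infinity in the bound \<open>e + N (\<sigma> j n - l n)\<close>, whose second term
          vanishes.\<close>
        show "(\<lambda>j. e + N (\<sigma> j n - l n)) \<longlonglongrightarrow> e"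
          using tendsto_add[OF tendsto_const[of e] l(2)[of n]] by simp
        show "\<forall>\<^sub>F j in sequentially. N (\<sigma> i n - l n) \<le> e + N (\<sigma> j n - l n)"
        proof (rule eventually_sequentiallyI[of k])
          fix j assume "k \<le> j"
          then show "N (\<sigma> i n - l n) \<le> e + N (\<sigma> j n - l n)"
            using k[OF \<open>k \<le> i\<close> \<open>k \<le> j\<close>] le[of i n j]
              norm_triangle[of "\<sigma> i n - \<sigma> j n" "\<sigma> j n - l n"]
            by (simp add: \<sigma>_in l diff_closed)
        qed
      qed simp
      then show ?thesis by blast
    qed
    have "l \<in> ell_infty B N"
    proof -
      obtain k where "\<And>n. N (\<sigma> k n - l n) \<le> 1"
        using uniform[of 1] by auto
      then have "N (l n) \<le> sup_norm N (\<sigma> k) + 1" for n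
        using norm_le_sup_norm[OF \<sigma>[of k], of n] norm_triangle_diff[of "l n" "\<sigma> k n"]
          norm_minus_commute[of "l n" "\<sigma> k n"] \<sigma>_in l(1) by (metis add_mono order_trans)
      then show ?thesis
        using l(1) by (rule ell_inftyI[rotated])
    qed
    moreover have "(\<lambda>i. sup_norm N (\<sigma> i - l)) \<longlonglongrightarrow> 0"
    proof (rule LIMSEQ_I)
      fix e :: real assume "0 < e"
      then obtain k where "\<And>i n. k \<le> i \<Longrightarrow> N (\<sigma> i n - l n) \<le> e / 2"
        using uniform[of "e / 2"] by auto
      then have "sup_norm N (\<sigma> i - l) \<le> e / 2" if "k \<le> i" for i
        using that by (intro sup_norm_le) simp
      then have "norm (sup_norm N (\<sigma> i - l) - 0) < e" if "k \<le> i" for i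
        using that \<open>0 < e\<close> ell.norm_nonneg[OF ell.diff_closed[OF \<sigma> \<open>l \<in> ell_infty B N\<close>], of i]
        by (smt (verit) diff_zero field_sum_of_halves real_norm_def)
      then show "\<exists>k. \<forall>i\<ge>k. norm (sup_norm N (\<sigma> i - l) - 0) < e"
        by blast
    qed
    ultimately show "\<exists>l\<in>ell_infty B N. (\<lambda>i. sup_norm N (\<sigma> i - l)) \<longlonglongrightarrow> 0" by blast
  qed
qed

end

section \<open>Linear maps with a power that halves the norm\<close>

lemma linear_onD:
  assumes "linear_on B T"
  shows "x \<in> B \<Longrightarrow> T x \<in> B"
    and "x \<in> B \<Longrightarrow> y \<in> B \<Longrightarrow> T (x + y) = T x + T y"
    and "x \<in> B \<Longrightarrow> T (c *\<^sub>R x) = c *\<^sub>R T x"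
  using assms by (auto simp: linear_on_def)

lemma (in normed_on) linear_on_diff:
  assumes "linear_on B T" "x \<in> B" "y \<in> B"
  shows "T (x - y) = T x - T y"
  using linear_onD(2,3)[OF assms(1)] assms(2,3) scale_closed[of y "- 1"]
  by (metis add.right_neutral add_uminus_conv_diff scaleR_minus1_left)

lemma linear_on_compose: "linear_on B S \<Longrightarrow> linear_on B T \<Longrightarrow> linear_on B (S \<circ> T)"
  by (auto simp: linear_on_def image_subset_iff)

lemma linear_on_funpow: "linear_on B T \<Longrightarrow> linear_on B (T ^^ k)"
proof (induction k)
  case 0
  then show ?case by (simp add: linear_on_def)
next
  case (Suc k)
  then show ?case unfolding funpow.simps by (simp only: linear_on_compose)
qed

text \<open>One application need not contract strictly; the power \<open>q\<close> gains the factor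
  1/2. The resolvent bound depends on \<open>q\<close> alone, so operators sharing it are inverted
  with one common constant.\<close>

locale power_contraction = normed_on B N for B :: "'v::real_vector set" and N +
  fixes T :: "'v \<Rightarrow> 'v" and q :: nat
  assumes linear: "linear_on B T"
    and contraction: "x \<in> B \<Longrightarrow> N (T x) \<le> N x"
    and power_half: "x \<in> B \<Longrightarrow> N ((T ^^ q) x) \<le> N x / 2"
begin

lemma power_closed: "x \<in> B \<Longrightarrow> (T ^^ k) x \<in> B"
  using linear_onD(1)[OF linear_on_funpow[OF linear]] .

lemma power_contraction: "x \<in> B \<Longrightarrow> N ((T ^^ k) x) \<le> N x"
proof (induction k)
  case (Suc k)
  then show ?case
    using contraction[OF power_closed[OF Suc.prems, of k]] by simp
qed simp

lemma sum_powers_closed: "x \<in> B \<Longrightarrow> (\<Sum>k<K. (T ^^ k) x) \<in> B"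
  by (simp add: power_closed subspace subspace_sum)

lemma telescope:
  assumes "z \<in> B"
  shows "(\<Sum>k<K. (T ^^ k) (z - T z)) = z - (T ^^ K) z"
proof -
  have "(T ^^ k) (z - T z) = (T ^^ k) z - (T ^^ Suc k) z" for k
    using linear_on_diff[OF linear_on_funpow[OF linear] assms linear_onD(1)[OF linear assms]]
    by (simp add: funpow_swap1)
  then show ?thesis
    using sum_lessThan_telescope'[of "\<lambda>k. (T ^^ k) z" K] by simp
qed

text \<open>By telescoping, \<open>z - (T ^^ q) z\<close> is a sum of \<open>q\<close> terms, each
  of norm at most that of \<open>z - T z\<close>. The remaining \<open>(T ^^ q) z\<close> has at
  most half the norm of \<open>z\<close> and is absorbed on the left.\<close>

lemma resolvent_bound:
  assumes z: "z \<in> B"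
  shows "N z \<le> 2 * real q * N (z - T z)"
proof -
  define x where "x = z - T z"
  have x: "x \<in> B"
    using z linear_onD(1)[OF linear z] by (simp add: x_def diff_closed)
  have "N (\<Sum>k<K. (T ^^ k) x) \<le> real K * N x" for K
  proof (induction K)
    case (Suc K)
    then show ?case
      using norm_triangle[OF sum_powers_closed[OF x, of K] power_closed[OF x, of K]]
        power_contraction[OF x, of K] by (simp add: algebra_simps)
  qed (simp add: norm_zero)
  from this[of q] have "N (z - (T ^^ q) z) \<le> real q * N x"
    using telescope[OF z] by (simp add: x_def)
  then show ?thesis
    using power_half[OF z] norm_triangle_diff[OF z power_closed[OF z, of q]] by (simp add: x_def)
qed

text \<open>The norm halves along the multiples of \<open>q\<close> and cannot increase between
  them.\<close>

lemma power_tendsto_zero: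
  assumes x: "x \<in> B"
  shows "(\<lambda>k. N ((T ^^ k) x)) \<longlonglongrightarrow> 0"
proof (rule LIMSEQ_I)
  fix e :: real assume "0 < e"
  have half: "N ((T ^^ (i * q)) x) \<le> N x * (1/2) ^ i" for i
  proof (induction i)
    case (Suc i)
    then show ?case
      using power_half[OF power_closed[OF x, of "i * q"]] by (simp add: funpow_add)
  qed simp
  have "(\<lambda>i. N x * (1/2) ^ i) \<longlonglongrightarrow> N x * 0"
    by (intro tendsto_intros LIMSEQ_realpow_zero) auto
  then have "\<forall>\<^sub>F i in sequentially. N x * (1/2) ^ i < e"
    using \<open>0 < e\<close> by (auto dest: order_tendstoD(2))
  then obtain i where i: "N x * (1/2) ^ i < e"
    by (auto simp: eventually_sequentially)
  have "N ((T ^^ k) x) < e" if "i * q \<le> k" for k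
  proof -
    have "(T ^^ k) x = (T ^^ (k - i * q)) ((T ^^ (i * q)) x)"
      using that by (metis comp_apply funpow_add le_add_diff_inverse2)
    then show ?thesis
      using power_contraction[OF power_closed[OF x, of "i * q"], of "k - i * q"] half[of i] i
      by simp
  qed
  then show "\<exists>k0. \<forall>k\<ge>k0. norm (N ((T ^^ k) x) - 0) < e"
    using norm_nonneg[OF power_closed[OF x]] by auto
qed

lemma id_minus_inj: "inj_on (\<lambda>x. x - T x) B"
proof (rule inj_onI)
  fix x y assume xy: "x \<in> B" "y \<in> B" and eq: "x - T x = y - T y"
  have "(x - y) - T (x - y) = 0"
    using eq by (simp add: linear_on_diff[OF linear xy] algebra_simps)
  then have "N (x - y) = 0"
    using resolvent_bound[OF diff_closed[OF xy]] norm_nonneg[OF diff_closed[OF xy]]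
    by (simp add: norm_zero)
  then show "x = y"
    using norm_eq_zero diff_closed xy by fastforce
qed

text \<open>The iterate of \<open>y \<mapsto> x + T y\<close> of order \<open>q\<close> is a strict contraction, so its unique
  fixed point is also a fixed point of the map itself.\<close>

lemma id_minus_surj:
  assumes "banach_on B N" and x: "x \<in> B"
  shows "\<exists>z\<in>B. z - T z = x"
proof -
  interpret metric: Metric_space B "norm_dist B N"
    by (rule Metric_space_norm_dist)
  define G where "G y = x + T y" for y
  have G: "y \<in> B \<Longrightarrow> G y \<in> B" for y
    by (simp add: G_def x add_closed linear_onD(1)[OF linear])
  have Gpow: "y \<in> B \<Longrightarrow> (G ^^ k) y \<in> B" for y k
    by (induction k) (simp_all add: G)
  have diff: "(G ^^ k) y - (G ^^ k) y' = (T ^^ k) (y - y')" if "y \<in> B" "y' \<in> B" for y y' k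
  proof (induction k)
    case (Suc k)
    then show ?case
      using linear_on_diff[OF linear Gpow[OF that(1), of k] Gpow[OF that(2), of k]]
      by (simp add: G_def[of "(G ^^ k) _"])
  qed simp
  have contr: "norm_dist B N ((G ^^ q) y) ((G ^^ q) y') \<le> 1/2 * norm_dist B N y y'"
    if "y \<in> B" "y' \<in> B" for y y'
    using that power_half[OF diff_closed[OF that]] by (simp add: norm_dist_def Gpow diff)
  obtain z where z: "z \<in> B" "(G ^^ q) z = z"
    by (rule metric.Banach_fixedpoint_thm[of "G ^^ q" "1/2"])
      (use assms contr Gpow banach_on.complete in auto)
  have "(G ^^ q) (G z) = G z"
    using z(2) by (metis funpow_swap1)
  then have "G z = z"
    using metric.contraction_imp_unique_fixpoint[of "G ^^ q" "G z" z "1/2"] z contr Gpow G by auto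
  then have "z - T z = x"
    by (metis G_def add_diff_cancel_right')
  with z(1) show ?thesis by blast
qed

lemma inverse_id_minus_eq: "z \<in> B \<Longrightarrow> inverse_id_minus B T (z - T z) = z"
  unfolding inverse_id_minus_def using the_inv_into_f_f[OF id_minus_inj] by simp

lemma neumann_invertible:
  assumes "banach_on B N"
  shows "neumann_invertible B N T"
  unfolding neumann_invertible_def
proof (intro conjI ballI)
  show "bij_betw (\<lambda>x. x - T x) B B"
    unfolding bij_betw_def
    using id_minus_inj id_minus_surj[OF assms] linear_onD(1)[OF linear] diff_closed
    by (auto simp: image_iff)
next
  fix x assume "x \<in> B"
  then obtain z where z: "z \<in> B" "x = z - T z"
    using id_minus_surj[OF assms] by metis
  \<comment> \<open>For \<open>x = z - T z\<close> the partial sum telescopes to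
    \<open>z - (T ^^ K) z\<close>, so the error is exactly \<open>(T ^^ K) z\<close>.\<close>
  show "(\<lambda>K. N (inverse_id_minus B T x - (\<Sum>k<K. (T ^^ k) x))) \<longlonglongrightarrow> 0"
    using power_tendsto_zero[OF z(1)]
    by (simp add: z(2) inverse_id_minus_eq[OF z(1)] telescope[OF z(1)])
qed

end

subsection \<open>Cocycles with loss of memory\<close>

text \<open>The recursion peels off the last operator; here the first one is split off, because the
  first step is used to move a weak measure into \<open>Bs\<close>.\<close>

lemma cocycle_Suc_shift: "cocycle T j (Suc k) x = cocycle T (j + 1) k (T j x)"
  by (induction k) (simp_all add: algebra_simps)

lemma linear_on_cocycle:
  assumes "\<And>n. linear_on B (T n)"
  shows "linear_on B (cocycle T j k)"
proof (induction k)
  case 0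
  then show ?case by (simp add: linear_on_def)
next
  case (Suc k)
  then show ?case unfolding cocycle.simps using assms by (intro linear_on_compose)
qed

lemma cocycle_closed: "(\<And>n x. x \<in> A \<Longrightarrow> T n x \<in> A) \<Longrightarrow> x \<in> A \<Longrightarrow> cocycle T j k x \<in> A"
  by (induction k) auto

text \<open>Coordinate \<open>n\<close> of the power is fed by coordinate \<open>n - k\<close>
  alone, so cocycle bounds uniform in the starting time become sup-norm bounds on powers of the
  global operator.\<close>

lemma global_op_funpow:
  "(global_op T ^^ k) x n = cocycle T (n - int k) k (x (n - int k))"
proof (induction k arbitrary: n)
  case (Suc k)
  have "(global_op T ^^ Suc k) x n = T (n - 1) ((global_op T ^^ k) x (n - 1))"
    by (simp add: global_op_def)
  also have "\<dots> = cocycle T (n - int (Suc k)) (Suc k) (x (n - int (Suc k)))"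
    using Suc.IH[of "n - 1"] by (simp add: algebra_simps)
  finally show ?case .
qed simp

lemma cocycle_equivariant:
  "(\<And>n. \<mu> (n + 1) = T n (\<mu> n)) \<Longrightarrow> cocycle T j k (\<mu> j) = \<mu> (j + int k)"
proof (induction k)
  case (Suc k)
  then show ?case
    using Suc.prems[of "j + int k"] by (simp add: algebra_simps)
qed simp

lemma linear_on_compress: "linear_on B p \<Longrightarrow> linear_on B T \<Longrightarrow> linear_on B (compress p T)"
  unfolding compress_def by (intro linear_on_compose)

lemma (in normed_on) onorm_on_bound:
  assumes T: "bounded_linear_on B N T" and x: "x \<in> B"
  shows "N (T x) \<le> onorm_on B N T * N x"
proof (cases "x = 0")
  case True
  moreover have "T (x - x) = T x - T x"
    using T x by (intro linear_on_diff) (auto simp: bounded_linear_on_def)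
  ultimately show ?thesis by (simp add: norm_zero)
next
  case False
  then have pos: "0 < N x"
    using norm_eq_zero[OF x] norm_nonneg[OF x] by simp
  obtain K where K: "\<And>y. y \<in> B \<Longrightarrow> N (T y) \<le> K * N y"
    using T by (auto simp: bounded_linear_on_def)
  \<comment> \<open>The maximum with 0 covers \<open>N y = 0\<close>, where division by zero gives
    the quotient 0.\<close>
  have "N (T y) / N y \<le> max K 0" if y: "y \<in> B" for y
  proof (cases "N y = 0")
    case False
    then have "N (T y) / N y \<le> K"
      using K[OF y] norm_nonneg[OF y] by (simp add: divide_le_eq)
    then show ?thesis by simp
  qed simp
  then have "bdd_above ((\<lambda>y. N (T y) / N y) ` B)"
    by (rule bdd_aboveI2)
  then have "N (T x) / N x \<le> onorm_on B N T"
    unfolding onorm_on_def using x by (rule cSUP_upper[rotated])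
  then show ?thesis
    using pos by (simp add: divide_le_eq)
qed

text \<open>The operator expansion is evaluated at one vector: the error of the difference quotient
  is the remainder at \<open>x\<close> divided by \<epsilon>, and \<open>onorm_on_bound\<close>
  controls it by the quotient that vanishes by \<open>small\<close>.\<close>

lemma (in normed_on) operator_derivative_at:
  assumes bounded: "\<forall>\<^sub>F \<epsilon> in at 0. bounded_linear_on B N (\<lambda>f. T \<epsilon> f - T 0 f - \<epsilon> *\<^sub>R D f)"
    and small: "(\<lambda>\<epsilon>. onorm_on B N (\<lambda>f. T \<epsilon> f - T 0 f - \<epsilon> *\<^sub>R D f)) \<in> o[at 0](\<lambda>\<epsilon>. \<epsilon>)"
    and x: "x \<in> B"
  shows "((\<lambda>\<epsilon>. N ((T \<epsilon> x - T 0 x) /\<^sub>R \<epsilon> - D x)) \<longlongrightarrow> 0) (at (0::real))"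
proof (rule Lim_null_comparison)
  define R where "R \<epsilon> = (\<lambda>f. T \<epsilon> f - T 0 f - \<epsilon> *\<^sub>R D f)" for \<epsilon> :: real
  have "((\<lambda>\<epsilon>. onorm_on B N (R \<epsilon>) / \<epsilon>) \<longlongrightarrow> 0) (at 0)"
    using smalloD_tendsto[OF small] by (simp add: R_def)
  then show "((\<lambda>\<epsilon>. \<bar>onorm_on B N (R \<epsilon>) / \<epsilon>\<bar> * N x) \<longlongrightarrow> 0) (at 0)"
    by (intro tendsto_mult_left_zero tendsto_rabs_zero)
  have "\<forall>\<^sub>F \<epsilon> :: real in at 0. \<epsilon> \<noteq> 0"
    by (simp add: eventually_at_filter)
  then show "\<forall>\<^sub>F \<epsilon> in at 0.
      norm (N ((T \<epsilon> x - T 0 x) /\<^sub>R \<epsilon> - D x)) \<le> \<bar>onorm_on B N (R \<epsilon>) / \<epsilon>\<bar> * N x"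
    using bounded
  proof eventually_elim
    case (elim \<epsilon>)
    have R: "bounded_linear_on B N (R \<epsilon>)"
      using elim(2) by (simp add: R_def)
    then have Rx: "R \<epsilon> x \<in> B"
      using x by (auto simp: bounded_linear_on_def linear_on_def)
    have "(T \<epsilon> x - T 0 x) /\<^sub>R \<epsilon> - D x = R \<epsilon> x /\<^sub>R \<epsilon>"
      using elim(1) by (simp add: R_def scaleR_diff_right)
    then have "norm (N ((T \<epsilon> x - T 0 x) /\<^sub>R \<epsilon> - D x)) = N (R \<epsilon> x) / \<bar>\<epsilon>\<bar>"
      using norm_scale[OF Rx, of "inverse \<epsilon>"] norm_nonneg[OF Rx]
      by (simp add: abs_mult divide_inverse_commute)
    also have "\<dots> \<le> onorm_on B N (R \<epsilon>) * N x / \<bar>\<epsilon>\<bar>"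
      using onorm_on_bound[OF R x] by (intro divide_right_mono) auto
    also have "\<dots> \<le> \<bar>onorm_on B N (R \<epsilon>)\<bar> * N x / \<bar>\<epsilon>\<bar>"
      using norm_nonneg[OF x] by (intro divide_right_mono mult_right_mono) auto
    finally show ?case by (simp add: abs_divide)
  qed
qed

section \<open>Weak decay of zero-mass measures and continuity of the total mass\<close>

locale memory_loss = strong: normed_on Bs ns + weak: banach_on Bw nw
  for Bs Bw :: "('a set \<Rightarrow> real) set" and ns nw +
  fixes M :: "'a measure"
    and L :: "int \<Rightarrow> ('a set \<Rightarrow> real) \<Rightarrow> 'a set \<Rightarrow> real"
    and h :: "int \<Rightarrow> 'a set \<Rightarrow> real"
    and C0 \<gamma> Creg :: real
  assumes Bs_subset: "Bs \<subseteq> Bw"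
    and norm_le: "\<mu> \<in> Bs \<Longrightarrow> nw \<mu> \<le> ns \<mu>"
    and markov: "markov_operator M Bs Bw (L n)"
    and equivariant: "equivariant_family M Bs ns L h"
    and C0: "1 \<le> C0" and \<gamma>: "0 < \<gamma>" and Creg: "0 < Creg"
    and loss_of_memory: "1 \<le> k \<Longrightarrow> v \<in> zero_mass M Bs \<Longrightarrow>
          ns (cocycle L j k v) \<le> C0 * exp (- \<gamma> * real k) * ns v"
    and weak_contraction: "f \<in> Bw \<Longrightarrow> nw (L n f) \<le> nw f"
    and regular: "f \<in> Bw \<Longrightarrow> L n f \<in> Bs"
    and regularization: "f \<in> Bw \<Longrightarrow> ns (L n f) \<le> Creg * nw f"
begin

lemma L_linear: "linear_on Bw (L n)"
  and L_mass: "f \<in> Bw \<Longrightarrow> L n f (space M) = f (space M)"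
  using markov[of n] by (auto simp: markov_operator_def preserves_mass_def)

lemma L_closed: "f \<in> Bw \<Longrightarrow> L n f \<in> Bw"
  using L_linear by (rule linear_onD(1))

lemma h_strong: "h n \<in> Bs"
  and h_weak: "h n \<in> Bw"
  and h_mass: "h n (space M) = 1"
  and h_step: "h (n + 1) = L n (h n)"
  and h_bdd: "bdd_above (range (\<lambda>n. ns (h n)))"
  using equivariant Bs_subset by (auto simp: equivariant_family_def prob_measures_def)

text \<open>\<open>1 \<le> C0\<close> adds the empty cocycle, which is what remains when the only
  step has been spent on regularization.\<close>

lemma loss_of_memory':
  assumes v: "v \<in> zero_mass M Bs"
  shows "ns (cocycle L j k v) \<le> C0 * exp (- \<gamma> * real k) * ns v"
proof (cases k)
  case 0
  then show ?thesis
    using mult_right_mono[OF C0, of "ns v"] v strong.norm_nonneg by (simp add: zero_mass_def)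
next
  case (Suc l)
  then show ?thesis using loss_of_memory[OF _ v, of k j] by simp
qed

lemma L_zero_mass: "f \<in> zero_mass M Bw \<Longrightarrow> L n f \<in> zero_mass M Bs"
  by (simp add: zero_mass_def regular L_mass)

text \<open>The first step pays \<open>Creg\<close> and lands in \<open>Bs\<close>; the other
  \<open>k\<close> steps decay in the strong norm, which dominates the weak one. Hence length
  \<open>Suc k\<close> goes with exponent \<open>k\<close>.\<close>

lemma weak_decay:
  assumes f: "f \<in> zero_mass M Bw"
  shows "nw (cocycle L j (Suc k) f) \<le> C0 * exp (- \<gamma> * real k) * (Creg * nw f)"
proof -
  let ?g = "L j f"
  have g: "?g \<in> zero_mass M Bs" and fw: "f \<in> Bw"
    using f L_zero_mass by (auto simp: zero_mass_def)
  have "cocycle L (j + 1) k ?g \<in> Bs"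
    by (rule cocycle_closed) (use g regular Bs_subset in \<open>auto simp: zero_mass_def\<close>)
  then have "nw (cocycle L j (Suc k) f) \<le> ns (cocycle L (j + 1) k ?g)"
    unfolding cocycle_Suc_shift by (rule norm_le)
  also have "\<dots> \<le> C0 * exp (- \<gamma> * real k) * ns ?g"
    by (rule loss_of_memory'[OF g])
  also have "\<dots> \<le> C0 * exp (- \<gamma> * real k) * (Creg * nw f)"
    using regularization[OF fw] C0 by (intro mult_left_mono) auto
  finally show ?thesis .
qed

text \<open>The total mass is not assumed to be continuous. It is, because \<open>\<mu>\<close> started at time
  \<open>n - k - 1\<close> becomes, for large \<open>k\<close>, close to \<open>\<mu> (space M)\<close> times \<open>h n\<close>, while its weak norm
  does not grow.\<close>

lemma mass_le:
  assumes \<mu>: "\<mu> \<in> Bw"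
  shows "\<bar>\<mu> (space M)\<bar> * nw (h n) \<le> nw \<mu>"
proof -
  define c where "c = \<mu> (space M)"
  obtain H where H: "\<And>n. nw (h n) \<le> H"
    using h_bdd norm_le[OF h_strong] by (auto simp: bdd_above_def) (meson order_trans)
  \<comment> \<open>\<open>A\<close> bounds \<open>Creg * nw (\<mu> - c *\<^sub>R h j)\<close> for
    every \<open>j\<close>; uniformity matters because the starting time \<open>j\<close> recedes as
    \<open>k\<close> grows.\<close>
  define A where "A = Creg * (nw \<mu> + \<bar>c\<bar> * H)"
  have bound: "\<bar>c\<bar> * nw (h n) \<le> nw \<mu> + C0 * exp (- \<gamma> * real k) * A" for k
  proof -
    define j where "j = n - int (Suc k)"
    let ?T = "cocycle L j (Suc k)"
    have T: "linear_on Bw ?T"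
      by (rule linear_on_cocycle) (rule L_linear)
    have ch: "c *\<^sub>R h j \<in> Bw"
      by (simp add: h_weak weak.scale_closed)
    \<comment> \<open>Each \<open>h j\<close> has mass 1, so subtracting \<open>c\<close> times it
      removes the mass of \<mu> and makes \<open>weak_decay\<close> applicable.\<close>
    have u: "\<mu> - c *\<^sub>R h j \<in> zero_mass M Bw"
      using \<mu> ch by (simp add: zero_mass_def weak.diff_closed h_mass c_def)
    have Th: "?T (c *\<^sub>R h j) = c *\<^sub>R h n"
      using linear_onD(3)[OF T h_weak] cocycle_equivariant[of h L j "Suc k"] h_step
      by (simp add: j_def)
    have "nw (?T f) \<le> nw f" if "f \<in> Bw" for f
    proof -
      have "nw (cocycle L j i f) \<le> nw f" for i
      proof (induction i)
        case (Suc i)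
        have "cocycle L j i f \<in> Bw"
          using L_closed that by (rule cocycle_closed)
        then show ?case
          using weak_contraction Suc.IH order_trans by fastforce
      qed simp
      then show ?thesis .
    qed
    then have "nw (?T \<mu>) \<le> nw \<mu>"
      using \<mu> by blast
    have "\<bar>c\<bar> * nw (h n) = nw (?T (c *\<^sub>R h j))"
      by (simp only: Th weak.norm_scale[OF h_weak])
    also have "\<dots> \<le> nw (?T \<mu>) + nw (?T (\<mu> - c *\<^sub>R h j))"
      using weak.norm_triangle_diff[of "?T (c *\<^sub>R h j)" "?T \<mu>"]
        weak.norm_minus_commute[of "?T (c *\<^sub>R h j)" "?T \<mu>"]
        weak.linear_on_diff[OF T \<mu> ch] linear_onD(1)[OF T \<mu>] linear_onD(1)[OF T ch]
      by (simp del: cocycle.simps)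
    also have "\<dots> \<le> nw \<mu> + C0 * exp (- \<gamma> * real k) * (Creg * nw (\<mu> - c *\<^sub>R h j))"
      using \<open>nw (?T \<mu>) \<le> nw \<mu>\<close> weak_decay[OF u] by (rule add_mono)
    also have "\<dots> \<le> nw \<mu> + C0 * exp (- \<gamma> * real k) * A"
    proof -
      have "nw (\<mu> - c *\<^sub>R h j) \<le> nw \<mu> + \<bar>c\<bar> * nw (h j)"
        using weak.norm_diff_le[OF \<mu> ch] by (simp add: weak.norm_scale[OF h_weak])
      also have "\<dots> \<le> nw \<mu> + \<bar>c\<bar> * H"
        using H by (simp add: mult_left_mono)
      finally show ?thesis
        unfolding A_def using C0 Creg by (intro add_left_mono mult_left_mono) auto
    qed
    finally show ?thesis .
  qed
  have "(\<lambda>k. exp (- \<gamma> * real k)) \<longlonglongrightarrow> 0"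
    using \<gamma> by real_asymp
  then have "(\<lambda>k. nw \<mu> + C0 * exp (- \<gamma> * real k) * A) \<longlonglongrightarrow> nw \<mu> + C0 * 0 * A"
    by (intro tendsto_intros)
  then show ?thesis
    using bound by (intro tendsto_lowerbound[where F = sequentially]) (auto simp: c_def)
qed

text \<open>By \<open>mass_le\<close> the absolute mass of \<open>l\<close> times
  \<open>nw (h 0)\<close> is at most the distance of \<open>\<sigma> x\<close> to \<open>l\<close>,
  and \<open>h 0\<close> is nonzero because its mass is 1. The general filter serves both the
  sequences in the completeness proof and the difference quotients as \<epsilon> tends to 0.\<close>

lemma zero_mass_limit:
  assumes "F \<noteq> bot" and l: "l \<in> Bw"
    and \<sigma>: "\<forall>\<^sub>F x in F. \<sigma> x \<in> zero_mass M Bw"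
    and lim: "((\<lambda>x. nw (\<sigma> x - l)) \<longlongrightarrow> 0) F"
  shows "l \<in> zero_mass M Bw"
proof -
  have "\<forall>\<^sub>F x in F. \<bar>l (space M)\<bar> * nw (h 0) \<le> nw (\<sigma> x - l)"
    using \<sigma>
  proof eventually_elim
    case (elim x)
    then show ?case
      using mass_le[of "\<sigma> x - l" 0] l by (simp add: zero_mass_def weak.diff_closed)
  qed
  then have "\<bar>l (space M)\<bar> * nw (h 0) \<le> 0"
    by (rule tendsto_lowerbound[OF lim _ \<open>F \<noteq> bot\<close>])
  moreover have "0 < nw (h 0)"
  proof -
    have "h 0 \<noteq> 0"
      using h_mass[of 0] by auto
    then show ?thesis
      using weak.norm_eq_zero[OF h_weak] weak.norm_nonneg[OF h_weak] by (metis less_eq_real_def)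
  qed
  ultimately show ?thesis
    using l by (simp add: zero_mass_def mult_le_0_iff)
qed

lemma subspace_zero_mass: "subspace (zero_mass M Bw)"
  by (rule subspaceI)
    (simp_all add: zero_mass_def weak.zero_closed weak.add_closed weak.scale_closed)

lemma banach_on_zero_mass: "banach_on (zero_mass M Bw) nw"
  using subspace_zero_mass
proof (rule weak.banach_on_closed_subspace)
  show "zero_mass M Bw \<subseteq> Bw" by (auto simp: zero_mass_def)
  show "l \<in> zero_mass M Bw"
    if "\<And>i. \<sigma> i \<in> zero_mass M Bw" "l \<in> Bw" "(\<lambda>i. nw (\<sigma> i - l)) \<longlonglongrightarrow> 0"
    for \<sigma> :: "nat \<Rightarrow> 'a set \<Rightarrow> real" and l
    using that by (intro zero_mass_limit[of sequentially l \<sigma>]) auto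
qed

text \<open>\<open>P = id\<close> will treat \<open>\<psi>\<close>, and \<open>P\<close> the
  projection will treat \<open>\<psi>m\<close>. The strong limit is a weak limit as well; the weak
  derivative \<open>D\<close> passes through \<open>P\<close> because \<open>P\<close> does not
  increase the weak norm, and uniqueness of weak limits identifies the two. Zero mass survives the
  weak limit.\<close>

lemma strong_derivative:
  fixes g :: "real \<Rightarrow> 'a set \<Rightarrow> real"
  assumes lim: "limitin (norm_topology Bs ns) (\<lambda>\<epsilon>. (P (g \<epsilon>) - P (g 0)) /\<^sub>R \<epsilon>) \<psi> (at 0)"
    and P: "linear_on Bw P" "preserves_mass M Bw P" "\<And>f. f \<in> Bw \<Longrightarrow> nw (P f) \<le> nw f"
    and g0: "g 0 \<in> Bw"
    and g: "\<forall>\<^sub>F \<epsilon> in at 0. g \<epsilon> \<in> Bw \<and> g \<epsilon> (space M) = g 0 (space M)"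
    and D: "D \<in> Bw" "((\<lambda>\<epsilon>. nw ((g \<epsilon> - g 0) /\<^sub>R \<epsilon> - D)) \<longlongrightarrow> 0) (at 0)"
  shows "\<psi> = P D" and "\<psi> \<in> zero_mass M Bs"
proof -
  interpret metric: Metric_space Bw "norm_dist Bw nw"
    by (rule weak.Metric_space_norm_dist)
  let ?q = "\<lambda>\<epsilon>. (P (g \<epsilon>) - P (g 0)) /\<^sub>R \<epsilon>"
  have strong: "\<psi> \<in> Bs" "\<forall>\<^sub>F \<epsilon> in at 0. ?q \<epsilon> \<in> Bs" "((\<lambda>\<epsilon>. ns (?q \<epsilon> - \<psi>)) \<longlongrightarrow> 0) (at 0)"
    using lim by (simp_all add: strong.limitin_norm)
  have \<psi>: "\<psi> \<in> Bw"
    using strong(1) Bs_subset by blast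
  have PD: "P D \<in> Bw"
    using P(1) D(1) by (rule linear_onD(1))
  \<comment> \<open>Conservation of mass along \<open>g\<close> cancels the mass of the quotient,
    and linearity moves \<open>P\<close> outside it.\<close>
  have q: "\<forall>\<^sub>F \<epsilon> in at 0. ?q \<epsilon> \<in> zero_mass M Bw \<and> ?q \<epsilon> - P D = P ((g \<epsilon> - g 0) /\<^sub>R \<epsilon> - D) \<and>
      (g \<epsilon> - g 0) /\<^sub>R \<epsilon> - D \<in> Bw"
    using g
  proof eventually_elim
    case (elim \<epsilon>)
    then have diff: "g \<epsilon> - g 0 \<in> Bw" "(g \<epsilon> - g 0) /\<^sub>R \<epsilon> \<in> Bw"
      using g0 by (simp_all add: weak.diff_closed weak.scale_closed)
    have "?q \<epsilon> = P ((g \<epsilon> - g 0) /\<^sub>R \<epsilon>)"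
      using elim linear_onD(3)[OF P(1) diff(1)] weak.linear_on_diff[OF P(1) _ g0] by simp
    moreover have "P ((g \<epsilon> - g 0) /\<^sub>R \<epsilon>) \<in> zero_mass M Bw"
      using linear_onD(1)[OF P(1) diff(2)] P(2) diff(2) elim
      by (simp add: zero_mass_def preserves_mass_def)
    ultimately show ?case
      using weak.linear_on_diff[OF P(1) diff(2) D(1)] weak.diff_closed[OF diff(2) D(1)] by simp
  qed
  then have q_weak: "\<forall>\<^sub>F \<epsilon> in at 0. ?q \<epsilon> \<in> Bw"
    by eventually_elim (simp add: zero_mass_def)
  have to_\<psi>: "((\<lambda>\<epsilon>. nw (?q \<epsilon> - \<psi>)) \<longlongrightarrow> 0) (at 0)"
  proof (rule Lim_null_comparison[OF _ strong(3)])
    show "\<forall>\<^sub>F \<epsilon> in at 0. norm (nw (?q \<epsilon> - \<psi>)) \<le> ns (?q \<epsilon> - \<psi>)"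
      using strong(2)
    proof eventually_elim
      case (elim \<epsilon>)
      then have *: "?q \<epsilon> - \<psi> \<in> Bs"
        using strong(1) by (rule strong.diff_closed)
      then show ?case
        using norm_le[OF *] weak.norm_nonneg[of "?q \<epsilon> - \<psi>"] Bs_subset by (simp add: subset_iff)
    qed
  qed
  have to_PD: "((\<lambda>\<epsilon>. nw (?q \<epsilon> - P D)) \<longlongrightarrow> 0) (at 0)"
  proof (rule Lim_null_comparison[OF _ D(2)])
    show "\<forall>\<^sub>F \<epsilon> in at 0. norm (nw (?q \<epsilon> - P D)) \<le> nw ((g \<epsilon> - g 0) /\<^sub>R \<epsilon> - D)"
      using q
    proof eventually_elim
      case (elim \<epsilon>)
      then show ?case
        using P(3) weak.norm_nonneg[OF linear_onD(1)[OF P(1)]] by simp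
    qed
  qed
  show "\<psi> = P D"
    by (rule metric.limitin_metric_unique[where F = "at (0::real)" and f = ?q])
      (use q_weak to_\<psi> to_PD \<psi> PD in \<open>simp_all add: weak.limitin_norm\<close>)
  have "\<psi> \<in> zero_mass M Bw"
    using q to_\<psi> \<psi> by (intro zero_mass_limit[of "at (0::real)" \<psi> ?q]) (auto elim: eventually_mono)
  then show "\<psi> \<in> zero_mass M Bs"
    using strong(1) by (simp add: zero_mass_def)
qed

end

subsection \<open>Compression by projections\<close>

text \<open>One fixed projection with error \<open>d\<close>, so that every estimate shows its
  dependence on \<open>m\<close> through \<open>d\<close>. The choice \<open>p = id\<close>,
  \<open>d = 0\<close> recovers the operators \<open>L\<close> themselves.\<close>

locale compressed_memory_loss = memory_loss Bs Bw ns nw M L h C0 \<gamma> Creg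
  for Bs Bw :: "('a set \<Rightarrow> real) set" and ns nw and M :: "'a measure" and L h C0 \<gamma> Creg +
  fixes p :: "('a set \<Rightarrow> real) \<Rightarrow> 'a set \<Rightarrow> real" and d :: real
  assumes d: "0 \<le> d"
    and proj: "projection_on Bw p"
    and proj_strong: "f \<in> Bs \<Longrightarrow> p f \<in> Bs"
    and proj_mass: "preserves_mass M Bw p"
    and proj_weak_contraction: "f \<in> Bw \<Longrightarrow> nw (p f) \<le> nw f"
    and proj_strong_contraction: "f \<in> Bs \<Longrightarrow> ns (p f) \<le> ns f"
    and proj_approx: "f \<in> Bs \<Longrightarrow> nw (p f - f) \<le> d * ns f"
begin

lemma proj_linear: "linear_on Bw p"
  and proj_idem: "f \<in> Bw \<Longrightarrow> p (p f) = p f"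
  using proj by (auto simp: projection_on_def)

lemma proj_closed: "f \<in> Bw \<Longrightarrow> p f \<in> Bw"
  using proj_linear by (rule linear_onD(1))

lemma compress_linear: "linear_on Bw (compress p (L n))"
  using proj_linear L_linear by (rule linear_on_compress)

lemma compress_regular: "f \<in> Bw \<Longrightarrow> compress p (L n) f \<in> Bs"
  by (simp add: compress_def proj_strong regular proj_closed)

lemma compress_closed: "f \<in> Bw \<Longrightarrow> compress p (L n) f \<in> Bw"
  using compress_regular Bs_subset by blast

lemma compress_mass: "f \<in> Bw \<Longrightarrow> compress p (L n) f (space M) = f (space M)"
  using proj_mass by (simp add: compress_def preserves_mass_def L_mass L_closed proj_closed)

lemma compress_weak_contraction: "f \<in> Bw \<Longrightarrow> nw (compress p (L n) f) \<le> nw f"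
  unfolding compress_def comp_apply
  by (meson L_closed order_trans proj_closed proj_weak_contraction weak_contraction)

lemma compress_regularization:
  assumes f: "f \<in> Bw"
  shows "ns (compress p (L n) f) \<le> Creg * nw f"
proof -
  have "ns (compress p (L n) f) \<le> Creg * nw (p f)"
    using proj_strong_contraction[OF regular[OF proj_closed[OF f]]]
      regularization[OF proj_closed[OF f]] unfolding compress_def comp_apply by (rule order_trans)
  also have "\<dots> \<le> Creg * nw f"
    using proj_weak_contraction[OF f] Creg by simp
  finally show ?thesis .
qed

lemma compress_zero_mass: "f \<in> zero_mass M Bw \<Longrightarrow> compress p (L n) f \<in> zero_mass M Bs"
  by (simp add: zero_mass_def compress_regular compress_mass)

lemma zero_mass_subset: "zero_mass M Bs \<subseteq> zero_mass M Bw"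
  using Bs_subset by (auto simp: zero_mass_def)

text \<open>The difference splits into \<open>p g - g\<close> with \<open>g = L n (p f)\<close>, and
  \<open>L n (p f - f)\<close>. Regularization gives \<open>g\<close> a strong norm of at most
  \<open>Creg * ns f\<close>, so the two errors are at most \<open>d * Creg * ns f\<close> and
  \<open>d * ns f\<close>.\<close>

lemma compress_diff:
  assumes f: "f \<in> Bs"
  shows "nw (compress p (L n) f - L n f) \<le> d * (Creg + 1) * ns f"
proof -
  have fw: "f \<in> Bw" and pf: "p f \<in> Bw" and Lpf: "L n (p f) \<in> Bs"
    using f Bs_subset proj_closed regular by auto
  have w: "p (L n (p f)) \<in> Bw" "L n (p f) \<in> Bw" "L n f \<in> Bw"
    using fw pf L_closed proj_closed by auto
  have "nw (p (L n (p f)) - L n (p f)) \<le> d * (Creg * ns f)"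
  proof -
    have "ns (L n (p f)) \<le> Creg * nw (p f)"
      by (rule regularization[OF pf])
    also have "\<dots> \<le> Creg * ns f"
      using proj_weak_contraction[OF fw] norm_le[OF f] Creg by simp
    finally show ?thesis
      using proj_approx[OF Lpf] d by (meson mult_left_mono order_trans)
  qed
  moreover have "nw (L n (p f) - L n f) \<le> d * ns f"
    using weak_contraction[OF weak.diff_closed[OF pf fw], of n] proj_approx[OF f]
    by (simp add: weak.linear_on_diff[OF L_linear pf fw])
  moreover have "nw (p (L n (p f)) - L n f) \<le>
      nw (p (L n (p f)) - L n (p f)) + nw (L n (p f) - L n f)"
    using weak.norm_triangle[of "p (L n (p f)) - L n (p f)" "L n (p f) - L n f"] w
    by (simp add: weak.diff_closed)
  ultimately show ?thesis
    by (simp add: compress_def algebra_simps)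
qed

text \<open>Telescoping: the compressed operator does not enlarge the error made so far, and each
  new error is \<open>compress_diff\<close> at the uncompressed orbit, whose strong norm stays at
  most \<open>C0 * ns f\<close>.\<close>

lemma cocycle_compress_diff:
  assumes f: "f \<in> zero_mass M Bs"
  shows "nw (cocycle (\<lambda>n. compress p (L n)) j k f - cocycle L j k f)
           \<le> real k * (d * (Creg + 1) * (C0 * ns f))"
proof (induction k)
  case (Suc k)
  let ?M = "compress p (L (j + int k))" and ?L = "L (j + int k)"
  let ?m = "cocycle (\<lambda>n. compress p (L n)) j k f" and ?l = "cocycle L j k f"
  have fs: "f \<in> Bs"
    using f by (simp add: zero_mass_def)
  have m: "?m \<in> Bw"
    by (rule cocycle_closed) (use fs compress_closed Bs_subset in auto)
  have l: "?l \<in> Bs"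
    by (rule cocycle_closed) (use fs regular Bs_subset in auto)
  then have lw: "?l \<in> Bw"
    using Bs_subset by blast
  have "nw (?M ?m - ?L ?l) \<le> nw (?M ?m - ?M ?l) + nw (?M ?l - ?L ?l)"
    using weak.norm_triangle[of "?M ?m - ?M ?l" "?M ?l - ?L ?l"] m lw
    by (simp add: weak.diff_closed compress_closed L_closed)
  also have "nw (?M ?m - ?M ?l) \<le> nw (?m - ?l)"
    using compress_weak_contraction[OF weak.diff_closed[OF m lw]]
    by (simp add: weak.linear_on_diff[OF compress_linear m lw])
  also note Suc.IH
  also have "nw (?M ?l - ?L ?l) \<le> d * (Creg + 1) * (C0 * ns f)"
  proof -
    have "ns ?l \<le> C0 * exp (- \<gamma> * real k) * ns f"
      by (rule loss_of_memory'[OF f])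
    also have "\<dots> \<le> C0 * ns f"
      using C0 \<gamma> strong.norm_nonneg[OF fs] by (intro mult_right_mono) auto
    finally show ?thesis
      using compress_diff[OF l] d Creg by (meson add_nonneg_nonneg less_imp_le
        mult_left_mono mult_nonneg_nonneg order_trans zero_le_one)
  qed
  finally show ?case
    by (simp add: distrib_right fun_diff_def)
qed (simp add: weak.norm_zero flip: zero_fun_def)

text \<open>One compressed step regularizes; the next \<open>k\<close> are compared with the
  uncompressed cocycle. The bound on the comparison error grows with \<open>k\<close>, so
  \<open>k\<close> is to be fixed first and \<open>d\<close> made small afterwards.\<close>

lemma compress_decay:
  assumes f: "f \<in> zero_mass M Bw"
  shows "nw (cocycle (\<lambda>n. compress p (L n)) j (Suc k) f)
           \<le> (C0 * exp (- \<gamma> * real k) + real k * (d * (Creg + 1) * C0)) * Creg * nw f"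
proof -
  let ?g = "compress p (L j) f"
  let ?m = "cocycle (\<lambda>n. compress p (L n)) (j + 1) k ?g" and ?l = "cocycle L (j + 1) k ?g"
  have g: "?g \<in> zero_mass M Bs" and fw: "f \<in> Bw"
    using f compress_zero_mass by (auto simp: zero_mass_def)
  then have gs: "?g \<in> Bs" by (simp add: zero_mass_def)
  have m: "?m \<in> Bw"
    by (rule cocycle_closed) (use gs compress_closed Bs_subset in auto)
  have l: "?l \<in> Bs"
    by (rule cocycle_closed) (use gs regular Bs_subset in auto)
  have "nw ?m \<le> nw ?l + nw (?m - ?l)"
    using m l Bs_subset by (intro weak.norm_triangle_diff) auto
  also have "\<dots> \<le> C0 * exp (- \<gamma> * real k) * ns ?g + real k * (d * (Creg + 1) * (C0 * ns ?g))"
    using norm_le[OF l] loss_of_memory'[OF g] cocycle_compress_diff[OF g]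
    by (meson add_mono order_trans)
  also have "\<dots> = (C0 * exp (- \<gamma> * real k) + real k * (d * (Creg + 1) * C0)) * ns ?g"
    by (simp add: algebra_simps)
  also have "\<dots> \<le> (C0 * exp (- \<gamma> * real k) + real k * (d * (Creg + 1) * C0)) * (Creg * nw f)"
    using compress_regularization[OF fw] C0 d Creg by (intro mult_left_mono) auto
  finally show ?thesis
    by (simp only: cocycle_Suc_shift mult.assoc)
qed

end

text \<open>\<open>half\<close> is the smallness that turns \<open>compress_decay\<close> into a
  factor 1/2. The number \<open>k\<close> is a separate parameter so that all large \<open>m\<close>
  can share it.\<close>

locale compressed_contraction = compressed_memory_loss Bs Bw ns nw M L h C0 \<gamma> Creg p d
  for Bs Bw :: "('a set \<Rightarrow> real) set" and ns nw and M :: "'a measure" and L h C0 \<gamma> Creg p d +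
  fixes k :: nat
  assumes half: "(C0 * exp (- \<gamma> * real k) + real k * (d * (Creg + 1) * C0)) * Creg \<le> 1 / 2"
begin

section \<open>Uniform inversion of the compressed global operators\<close>

sublocale zero: banach_on "zero_mass M Bw" nw
  by (rule banach_on_zero_mass)

sublocale seq: banach_on "ell_infty (zero_mass M Bw) nw" "sup_norm nw"
  by (rule zero.banach_on_ell_infty)

sublocale global: power_contraction "ell_infty (zero_mass M Bw) nw" "sup_norm nw"
  "global_op (\<lambda>n. compress p (L n))" "Suc k"
proof
  let ?V = "ell_infty (zero_mass M Bw) nw" and ?T = "global_op (\<lambda>n. compress p (L n))"
  have closed: "?T x \<in> ?V" and le: "sup_norm nw (?T x) \<le> sup_norm nw x" if x: "x \<in> ?V" for x
  proof -
    have x_n: "x n \<in> zero_mass M Bw" "x n \<in> Bw" for n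
      using zero.ell_inftyD[OF x, of n] by (auto simp: zero_mass_def)
    have le: "nw (?T x n) \<le> sup_norm nw x" for n
      using compress_weak_contraction[OF x_n(2)] zero.norm_le_sup_norm[OF x]
      unfolding global_op_def by (rule order_trans)
    show "?T x \<in> ?V"
      using le by (rule zero.ell_inftyI[rotated])
        (use compress_zero_mass x_n zero_mass_subset in \<open>auto simp: global_op_def\<close>)
    show "sup_norm nw (?T x) \<le> sup_norm nw x"
      using le by (rule zero.sup_norm_le)
  qed
  show "linear_on ?V ?T"
    unfolding linear_on_def
  proof (intro conjI ballI allI)
    show "?T ` ?V \<subseteq> ?V" using closed by blast
    have x_n: "x n \<in> Bw" if "x \<in> ?V" for x n
      using zero.ell_inftyD[OF that, of n] by (simp add: zero_mass_def)
    show "?T (x + y) = ?T x + ?T y" if "x \<in> ?V" "y \<in> ?V" for x y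
      using linear_onD(2)[OF compress_linear] x_n that by (simp add: global_op_def fun_eq_iff)
    show "?T (c *\<^sub>R x) = c *\<^sub>R ?T x" if "x \<in> ?V" for c x
      using linear_onD(3)[OF compress_linear] x_n that by (simp add: global_op_def fun_eq_iff)
  qed
  show "sup_norm nw (?T x) \<le> sup_norm nw x" if "x \<in> ?V" for x
    using that by (rule le)
  show "sup_norm nw ((?T ^^ Suc k) x) \<le> sup_norm nw x / 2" if x: "x \<in> ?V" for x
  proof (rule zero.sup_norm_le)
    fix n
    let ?y = "x (n - int (Suc k))"
    have y: "?y \<in> zero_mass M Bw"
      using x by (rule zero.ell_inftyD)
    have "nw ((?T ^^ Suc k) x n) \<le> 1 / 2 * nw ?y"
      unfolding global_op_funpow
      using compress_decay[OF y] mult_right_mono[OF half zero.norm_nonneg[OF y]]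
      by (rule order_trans)
    also have "\<dots> \<le> sup_norm nw x / 2"
      using zero.norm_le_sup_norm[OF x] by simp
    finally show "nw ((?T ^^ Suc k) x n) \<le> sup_norm nw x / 2" .
  qed
qed

lemma compress_neumann_invertible:
  "neumann_invertible (ell_infty (zero_mass M Bw) nw) (sup_norm nw)
     (global_op (\<lambda>n. compress p (L n)))"
  using global.neumann_invertible seq.banach_on_axioms by blast

text \<open>This is the resolvent bound for \<open>hm - h\<close>. The strong bound on
  \<open>hm\<close> places the difference in the sequence space; the final constant involves
  \<open>H\<close> but no bound on \<open>hm\<close>, hence is uniform in the projection up to
  \<open>d\<close>.\<close>

lemma equivariant_diff:
  assumes hm: "equivariant_family M Bs ns (\<lambda>n. compress p (L n)) hm"
    and H: "\<And>n. ns (h n) \<le> H"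
  shows "nw (hm n - h n) \<le> 2 * real (Suc k) * (d * (Creg + 1) * H)"
proof -
  let ?V = "ell_infty (zero_mass M Bw) nw" and ?T = "global_op (\<lambda>n. compress p (L n))"
  have hm_s: "hm n \<in> Bs" and hm_mass: "hm n (space M) = 1"
    and hm_step: "hm (n + 1) = compress p (L n) (hm n)" for n
    using hm by (auto simp: equivariant_family_def prob_measures_def)
  obtain H' where H': "\<And>n. ns (hm n) \<le> H'"
    using hm by (auto simp: equivariant_family_def bdd_above_def)
  have hm_w: "hm n \<in> Bw" for n
    using hm_s Bs_subset by blast
  have bound: "nw ((hm - h) n) \<le> H' + H" for n
    using weak.norm_diff_le[OF hm_w h_weak, of n n] norm_le[OF hm_s, of n] norm_le[OF h_strong, of n]
      H[of n] H'[of n] by simp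
  have V: "hm - h \<in> ?V"
    using bound by (rule zero.ell_inftyI[rotated])
      (use hm_mass h_mass in \<open>simp add: zero_mass_def weak.diff_closed hm_w h_weak\<close>)
  have "nw (((hm - h) - ?T (hm - h)) n) \<le> d * (Creg + 1) * H" for n
  proof -
    \<comment> \<open>Equivariance of \<open>hm\<close> cancels every term containing it and leaves
      the one-step compression error at \<open>h\<close>.\<close>
    have "((hm - h) - ?T (hm - h)) n
        = compress p (L (n - 1)) (h (n - 1)) - L (n - 1) (h (n - 1))"
      using hm_step[of "n - 1"] h_step[of "n - 1"]
      by (simp add: global_op_def weak.linear_on_diff[OF compress_linear hm_w h_weak])
    then have "nw (((hm - h) - ?T (hm - h)) n) \<le> d * (Creg + 1) * ns (h (n - 1))"
      using compress_diff[OF h_strong, of "n - 1" "n - 1"] by simp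
    also have "\<dots> \<le> d * (Creg + 1) * H"
      using H d Creg by (intro mult_left_mono) auto
    finally show ?thesis .
  qed
  then have "sup_norm nw ((hm - h) - ?T (hm - h)) \<le> d * (Creg + 1) * H"
    by (rule zero.sup_norm_le)
  then have "2 * real (Suc k) * sup_norm nw ((hm - h) - ?T (hm - h))
      \<le> 2 * real (Suc k) * (d * (Creg + 1) * H)"
    by (intro mult_left_mono) auto
  with global.resolvent_bound[OF V] zero.norm_le_sup_norm[OF V, of n] show ?thesis
    unfolding minus_apply by (meson order_trans)
qed

text \<open>Projection errors are controlled on \<open>Bs\<close>, which is why a strong bound
  \<open>Z\<close> on the uncompressed response enters, whereas the compressed response enters as a
  weak sequence.\<close>

lemma compress_response_diff:
  assumes z: "z \<in> ell_infty (zero_mass M Bw) nw" "\<And>n. z n \<in> Bs" "\<And>n. ns (z n) \<le> Z"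
    and z_eq: "z - global_op L z = \<psi>"
    and zm: "zm \<in> ell_infty (zero_mass M Bw) nw"
    and zm_eq: "zm - global_op (\<lambda>n. compress p (L n)) zm = \<psi>m"
    and E: "\<And>n. nw (\<psi>m n - p (\<psi> n)) \<le> E"
  shows "global_proj p z \<in> ell_infty (zero_mass M Bw) nw"
    and "sup_norm nw (zm - global_proj p z) \<le> 2 * real (Suc k) * (E + d * Z)"
proof -
  let ?V = "ell_infty (zero_mass M Bw) nw" and ?T = "global_op (\<lambda>n. compress p (L n))"
  have z_w: "z n \<in> Bw" and z_mass: "z n (space M) = 0" and zm_w: "zm n \<in> Bw" for n
    using zero.ell_inftyD[OF z(1), of n] zero.ell_inftyD[OF zm, of n]
    by (auto simp: zero_mass_def)
  have "nw (global_proj p z n) \<le> sup_norm nw z" for n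
    using proj_weak_contraction[OF z_w] zero.norm_le_sup_norm[OF z(1)]
    unfolding global_proj_def by (rule order_trans)
  then show V: "global_proj p z \<in> ?V"
    by (rule zero.ell_inftyI[rotated])
      (use proj_mass z_mass in \<open>simp add: global_proj_def zero_mass_def preserves_mass_def z_w proj_closed\<close>)
  define w where "w = zm - global_proj p z"
  have w: "w \<in> ?V"
    using zm V by (simp add: w_def seq.diff_closed)
  have "nw ((w - ?T w) n) \<le> E + d * Z" for n
  proof -
    let ?y = "z (n - 1)" and ?ym = "zm (n - 1)" and ?L = "L (n - 1)"
    have y: "?y \<in> Bw" "p ?y \<in> Bw" "?L ?y \<in> Bw" "?L (p ?y) \<in> Bw"
      by (simp_all add: z_w proj_closed L_closed)
    have \<psi>_n: "\<psi> n = z n - ?L ?y" and \<psi>m_n: "\<psi>m n = zm n - compress p ?L ?ym"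
      using z_eq zm_eq by (auto simp: global_op_def)
    have \<psi>_w: "\<psi> n \<in> Bw" "\<psi>m n \<in> Bw"
      unfolding \<psi>_n \<psi>m_n by (simp_all add: weak.diff_closed z_w zm_w L_closed compress_closed)
    have p\<psi>: "p (\<psi> n) = p (z n) - p (?L ?y)"
      unfolding \<psi>_n by (rule weak.linear_on_diff[OF proj_linear z_w y(3)])
    have "w (n - 1) = ?ym - p ?y"
      by (simp add: w_def global_proj_def)
    then have "?T w n = compress p ?L ?ym - compress p ?L (p ?y)"
      unfolding global_op_def
      by (simp only: weak.linear_on_diff[OF compress_linear zm_w y(2)])
    \<comment> \<open>Idempotence absorbs the inner projection, so that this term can be compared
      with \<open>p (?L ?y)\<close> coming from \<open>p (\<psi> n)\<close>.\<close>
    also have "compress p ?L (p ?y) = p (?L (p ?y))"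
      by (simp add: compress_def proj_idem y)
    finally have T_w: "?T w n = compress p ?L ?ym - p (?L (p ?y))" .
    have "w n = zm n - p (z n)"
      by (simp add: w_def global_proj_def)
    then have "(w - ?T w) n = (\<psi>m n - p (\<psi> n)) + (p (?L (p ?y)) - p (?L ?y))"
      unfolding p\<psi> \<psi>m_n minus_apply[of w] T_w by simp
    also have "p (?L (p ?y)) - p (?L ?y) = p (?L (p ?y - ?y))"
      using weak.linear_on_diff[OF proj_linear y(4,3)] weak.linear_on_diff[OF L_linear y(2,1)]
      by simp
    finally have eq: "(w - ?T w) n = (\<psi>m n - p (\<psi> n)) + p (?L (p ?y - ?y))" .
    have "nw ((w - ?T w) n) \<le> nw (\<psi>m n - p (\<psi> n)) + nw (p (?L (p ?y - ?y)))"
      unfolding eq by (intro weak.norm_triangle weak.diff_closed proj_closed L_closed \<psi>_w y)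
    also have "nw (p (?L (p ?y - ?y))) \<le> nw (p ?y - ?y)"
      using y by (meson L_closed order_trans proj_weak_contraction weak.diff_closed weak_contraction)
    also have "nw (p ?y - ?y) \<le> d * Z"
      using proj_approx[OF z(2)] mult_left_mono[OF z(3) d] by (rule order_trans)
    also have "nw (\<psi>m n - p (\<psi> n)) \<le> E" by (rule E)
    finally show ?thesis by simp
  qed
  then have "sup_norm nw (w - ?T w) \<le> E + d * Z"
    by (rule zero.sup_norm_le)
  then have "2 * real (Suc k) * sup_norm nw (w - ?T w) \<le> 2 * real (Suc k) * (E + d * Z)"
    by (intro mult_left_mono) auto
  with global.resolvent_bound[OF w] show "sup_norm nw (zm - global_proj p z) \<le> 2 * real (Suc k) * (E + d * Z)"
    unfolding w_def[symmetric] by (rule order_trans)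
qed

end

subsection \<open>Convergence of the linear response\<close>

theorem proposition24:
  fixes M :: "'a measure"
    and Bs Bw :: "('a set \<Rightarrow> real) set"
    and ns nw :: "('a set \<Rightarrow> real) \<Rightarrow> real"
    and L :: "real \<Rightarrow> int \<Rightarrow> ('a set \<Rightarrow> real) \<Rightarrow> ('a set \<Rightarrow> real)"
    and Ldot :: "int \<Rightarrow> ('a set \<Rightarrow> real) \<Rightarrow> ('a set \<Rightarrow> real)"
    and \<pi> :: "nat \<Rightarrow> ('a set \<Rightarrow> real) \<Rightarrow> ('a set \<Rightarrow> real)"
    and h \<psi> :: "int \<Rightarrow> 'a set \<Rightarrow> real"
    and hm \<psi>m :: "nat \<Rightarrow> int \<Rightarrow> 'a set \<Rightarrow> real"
    and \<delta> :: "nat \<Rightarrow> real"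
    and C0 \<gamma> B lam Creg :: real
  assumes signed_measures: "\<And>\<mu>. \<mu> \<in> Bw \<Longrightarrow> finite_signed_measure M \<mu>"
    and banach_s: "banach_on Bs ns"
    and banach_w: "banach_on Bw nw"
    and subset: "Bs \<subseteq> Bw"
    and norm_le: "\<And>\<mu>. \<mu> \<in> Bs \<Longrightarrow> nw \<mu> \<le> ns \<mu>"
    and markov: "\<forall>\<^sub>F \<epsilon> in nhds 0. \<forall>n. markov_operator M Bs Bw (L \<epsilon> n)"
    and proj: "\<And>m. 1 \<le> m \<Longrightarrow> projection_on Bw (\<pi> m)"
    and proj_strong: "\<And>m. 1 \<le> m \<Longrightarrow> \<pi> m ` Bs \<subseteq> Bs"
    and equivariant: "equivariant_family M Bs ns (L 0) h"
    and equivariant_m: "\<And>m. 1 \<le> m \<Longrightarrow>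
          equivariant_family M Bs ns (\<lambda>n. compress (\<pi> m) (L 0 n)) (hm m)"
    \<comment> \<open>(a)\<close>
    and "1 \<le> C0" "0 < \<gamma>"
    and loss_of_memory: "\<And>j k v. 1 \<le> k \<Longrightarrow> v \<in> zero_mass M Bs \<Longrightarrow>
          ns (cocycle (L 0) j k v) \<le> C0 * exp (- \<gamma> * real k) * ns v"
    \<comment> \<open>(b)\<close>
    and proj_mass: "\<And>m. 1 \<le> m \<Longrightarrow> preserves_mass M Bw (\<pi> m)"
    and proj_weak_contraction: "\<And>m f. 1 \<le> m \<Longrightarrow> f \<in> Bw \<Longrightarrow> nw (\<pi> m f) \<le> nw f"
    and proj_strong_contraction: "\<And>m f. 1 \<le> m \<Longrightarrow> f \<in> Bs \<Longrightarrow> ns (\<pi> m f) \<le> ns f"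
    and proj_approx: "\<And>m f. 1 \<le> m \<Longrightarrow> f \<in> Bs \<Longrightarrow> nw (\<pi> m f - f) \<le> \<delta> m * ns f"
    and delta_tendsto: "\<delta> \<longlonglongrightarrow> 0"
    \<comment> \<open>(c)\<close>
    and weak_contraction: "\<And>n f. f \<in> Bw \<Longrightarrow> nw (L 0 n f) \<le> nw f"
    and "1 \<le> B" "0 \<le> lam" "lam < 1"
    and lasota_yorke: "\<And>n f. f \<in> Bs \<Longrightarrow> ns (L 0 n f) \<le> lam * ns f + B * nw f"
    and lasota_yorke_m: "\<And>m n f. 1 \<le> m \<Longrightarrow> f \<in> Bs \<Longrightarrow>
          ns (compress (\<pi> m) (L 0 n) f) \<le> lam * ns f + B * nw f"
    \<comment> \<open>(d)\<close>
    and psi: "\<And>n. limitin (norm_topology Bs ns)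
          (\<lambda>\<epsilon>. (L \<epsilon> (n - 1) (h (n - 1)) - L 0 (n - 1) (h (n - 1))) /\<^sub>R \<epsilon>) (\<psi> n) (at 0)"
    and psi_m: "\<And>m n. 1 \<le> m \<Longrightarrow> limitin (norm_topology Bs ns)
          (\<lambda>\<epsilon>. (compress (\<pi> m) (L \<epsilon> (n - 1)) (hm m (n - 1)) -
                compress (\<pi> m) (L 0 (n - 1)) (hm m (n - 1))) /\<^sub>R \<epsilon>) (\<psi>m m n) (at 0)"
    and psi_bdd: "bdd_above (range (\<lambda>n. ns (\<psi> n)))"
    and psi_m_bdd: "\<And>m. 1 \<le> m \<Longrightarrow> bdd_above (range (\<lambda>n. ns (\<psi>m m n)))"
    \<comment> \<open>(e)\<close>
    and Ldot: "\<And>n. bounded_linear_on Bw nw (Ldot n)"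
    and Ldot_remainder_bounded: "\<And>n. \<forall>\<^sub>F \<epsilon> in at 0.
          bounded_linear_on Bw nw (\<lambda>f. L \<epsilon> n f - L 0 n f - \<epsilon> *\<^sub>R Ldot n f)"
    and Ldot_derivative: "\<And>n.
          (\<lambda>\<epsilon>. onorm_on Bw nw (\<lambda>f. L \<epsilon> n f - L 0 n f - \<epsilon> *\<^sub>R Ldot n f)) \<in> o[at 0](\<lambda>\<epsilon>. \<epsilon>)"
    and Ldot_bdd: "bdd_above (range (\<lambda>n. onorm_on Bw nw (Ldot n)))"
    \<comment> \<open>(f)\<close>
    and "0 < Creg"
    and regularization: "\<And>n f. f \<in> Bw \<Longrightarrow> L 0 n f \<in> Bs \<and> ns (L 0 n f) \<le> Creg * nw f"
  shows "let V = ell_infty (zero_mass M Bw) nw;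
             F = global_op (L 0);
             Fm = (\<lambda>m. global_op (\<lambda>n. compress (\<pi> m) (L 0 n)));
             hhat = inverse_id_minus V F \<psi>;
             hhatm = (\<lambda>m. inverse_id_minus V (Fm m) (\<psi>m m))
         in neumann_invertible V (sup_norm nw) F \<and> \<psi> \<in> V \<and>
            (\<forall>\<^sub>F m in sequentially. neumann_invertible V (sup_norm nw) (Fm m) \<and> \<psi>m m \<in> V) \<and>
            (\<lambda>m. sup_norm nw (hhatm m - global_proj (\<pi> m) hhat)) \<longlonglongrightarrow> 0"
proof -

  \<comment> \<open>Choice of the power and of the admissible indices\<close>
  let ?V = "ell_infty (zero_mass M Bw) nw"
  have L_markov: "markov_operator M Bs Bw (L 0 n)" for n
    using eventually_nhds_x_imp_x[OF markov] by blast
  interpret weak: banach_on Bw nw by (rule banach_w)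
  interpret base: memory_loss Bs Bw ns nw M "L 0" h C0 \<gamma> Creg
    using banach_s banach_w assms(4,5,9,11-13) L_markov weak_contraction \<open>0 < Creg\<close> regularization
    by (intro memory_loss.intro memory_loss_axioms.intro banach_on.axioms(1)) auto
  have "(\<lambda>k. C0 * exp (- \<gamma> * real k) * Creg) \<longlonglongrightarrow> 0"
    using \<open>0 < \<gamma>\<close> by real_asymp
  then have "\<forall>\<^sub>F k in sequentially. C0 * exp (- \<gamma> * real k) * Creg < 1 / 2"
    by (rule order_tendstoD) simp
  \<comment> \<open>The strict inequality leaves room for the compression error of all large
    \<open>m\<close>.\<close>
  then obtain k where k: "C0 * exp (- \<gamma> * real k) * Creg < 1 / 2"
    by (auto simp: eventually_sequentially)
  \<comment> \<open>The identity is a projection with error 0, so the uncompressed global operator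
    is inverted by the same argument.\<close>
  interpret limit: compressed_contraction Bs Bw ns nw M "L 0" h C0 \<gamma> Creg id 0 k
    using k by unfold_locales
      (auto simp: projection_on_def linear_on_def preserves_mass_def weak.norm_zero)
  have [simp]: "compress id T = T" for T :: "('a set \<Rightarrow> real) \<Rightarrow> 'a set \<Rightarrow> real"
    by (simp add: compress_def)
  \<comment> \<open>The absolute value of \<open>\<delta> m\<close> provides the nonnegative error
    constant that the locale asks for.\<close>
  define good where "good m \<longleftrightarrow> 1 \<le> m \<and>
    (C0 * exp (- \<gamma> * real k) + real k * (\<bar>\<delta> m\<bar> * (Creg + 1) * C0)) * Creg \<le> 1 / 2" for m
  have \<delta>_abs: "(\<lambda>m. \<bar>\<delta> m\<bar>) \<longlonglongrightarrow> 0"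
    using delta_tendsto by (rule tendsto_rabs_zero)
  have good: "\<forall>\<^sub>F m in sequentially. good m"
  proof -
    have "(\<lambda>m. (C0 * exp (- \<gamma> * real k) + real k * (\<bar>\<delta> m\<bar> * (Creg + 1) * C0)) * Creg)
        \<longlonglongrightarrow> (C0 * exp (- \<gamma> * real k) + real k * (0 * (Creg + 1) * C0)) * Creg"
      by (intro tendsto_intros \<delta>_abs)
    then have "\<forall>\<^sub>F m in sequentially.
        (C0 * exp (- \<gamma> * real k) + real k * (\<bar>\<delta> m\<bar> * (Creg + 1) * C0)) * Creg < 1 / 2"
      by (rule order_tendstoD) (use k in simp)
    with eventually_ge_at_top[of 1] show ?thesis
      by eventually_elim (simp add: good_def)
  qed
  have contraction: "compressed_contraction Bs Bw ns nw M (L 0) h C0 \<gamma> Creg (\<pi> m) \<bar>\<delta> m\<bar> k"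
    if "good m" for m
  proof unfold_locales
    have m: "1 \<le> m" using that by (simp add: good_def)
    show "nw (\<pi> m f - f) \<le> \<bar>\<delta> m\<bar> * ns f" if "f \<in> Bs" for f
      using proj_approx[OF m that] mult_right_mono[OF abs_ge_self base.strong.norm_nonneg[OF that]]
      by (rule order_trans)
    show "projection_on Bw (\<pi> m)" "preserves_mass M Bw (\<pi> m)"
      using m proj proj_mass by auto
    show "\<pi> m f \<in> Bs" "ns (\<pi> m f) \<le> ns f" if "f \<in> Bs" for f
      using m that proj_strong proj_strong_contraction by auto
    show "nw (\<pi> m f) \<le> nw f" if "f \<in> Bw" for f
      using m that by (rule proj_weak_contraction)
  qed (use that in \<open>auto simp: good_def\<close>)

  \<comment> \<open>Formulas for the derivative sequences\<close>
  obtain K where K: "0 \<le> K" "\<And>n f. f \<in> Bw \<Longrightarrow> nw (Ldot n f) \<le> K * nw f"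
  proof -
    obtain K where K: "\<And>n. onorm_on Bw nw (Ldot n) \<le> K"
      using Ldot_bdd by (auto simp: bdd_above_def)
    have "nw (Ldot n f) \<le> max K 0 * nw f" if "f \<in> Bw" for n f
      using weak.onorm_on_bound[OF Ldot that, of n]
        mult_right_mono[OF order_trans[OF K[of n] max.cobounded1[of K 0]] weak.norm_nonneg[OF that]]
      by (rule order_trans)
    then show thesis by (intro that[of "max K 0"]) auto
  qed
  have Ldot_linear: "linear_on Bw (Ldot n)" for n
    using Ldot by (simp add: bounded_linear_on_def)
  \<comment> \<open>Near 0 all operators conserve mass, so perturbed and unperturbed images have
    equal mass and their difference quotients have mass 0.\<close>
  have markov_orbit: "\<forall>\<^sub>F \<epsilon> in at 0. L \<epsilon> n f \<in> Bw \<and> L \<epsilon> n f (space M) = L 0 n f (space M)"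
    if "f \<in> Bw" for n f
  proof -
    have "\<forall>\<^sub>F \<epsilon> in at 0. markov_operator M Bs Bw (L \<epsilon> n)"
      using markov by (auto simp: eventually_at_filter elim: eventually_mono)
    then show ?thesis
      by eventually_elim
        (use that base.L_mass in \<open>auto simp: markov_operator_def preserves_mass_def linear_on_def\<close>)
  qed
  note derivative = weak.operator_derivative_at[OF Ldot_remainder_bounded Ldot_derivative]
  have \<psi>_eq: "\<psi> n = Ldot (n - 1) (h (n - 1))" and \<psi>_zero: "\<psi> n \<in> zero_mass M Bs" for n
    using base.strong_derivative[of id "\<lambda>\<epsilon>. L \<epsilon> (n - 1) (h (n - 1))" "\<psi> n" "Ldot (n - 1) (h (n - 1))"]
      psi[of n] derivative[OF base.h_weak] markov_orbit[OF base.h_weak] base.L_closed base.h_weak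
      linear_onD(1)[OF Ldot_linear]
    by (auto simp: linear_on_def preserves_mass_def)
  have \<psi>m_eq: "\<psi>m m n = \<pi> m (Ldot (n - 1) (hm m (n - 1)))"
    and \<psi>m_zero: "\<psi>m m n \<in> zero_mass M Bs" if "good m" for m n
  proof -
    interpret c: compressed_contraction Bs Bw ns nw M "L 0" h C0 \<gamma> Creg "\<pi> m" "\<bar>\<delta> m\<bar>" k
      using that by (rule contraction)
    have m: "1 \<le> m" using that by (simp add: good_def)
    have hm: "hm m i \<in> Bw" for i
      using equivariant_m[OF m] subset by (auto simp: equivariant_family_def prob_measures_def)
    \<comment> \<open>Equivariance writes \<open>hm m i\<close> as a value of
      \<open>\<pi> m\<close>. Hence the inner projection of the compression disappears and
      \<open>strong_derivative\<close> applies with \<open>P = \<pi> m\<close>.\<close>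
    have p_hm: "\<pi> m (hm m i) = hm m i" for i
    proof -
      have "hm m i = compress (\<pi> m) (L 0 (i - 1)) (hm m (i - 1))"
        using equivariant_m[OF m] by (metis diff_add_cancel equivariant_family_def)
      then show ?thesis
        using hm by (simp add: compress_def c.proj_idem c.proj_closed base.L_closed)
    qed
    have "limitin (norm_topology Bs ns)
        (\<lambda>\<epsilon>. (\<pi> m (L \<epsilon> (n - 1) (hm m (n - 1))) - \<pi> m (L 0 (n - 1) (hm m (n - 1)))) /\<^sub>R \<epsilon>)
        (\<psi>m m n) (at 0)"
      using psi_m[OF m, of n] by (simp add: compress_def p_hm)
    from base.strong_derivative[where g = "\<lambda>\<epsilon>. L \<epsilon> (n - 1) (hm m (n - 1))", OF this c.proj_linear
        c.proj_mass c.proj_weak_contraction base.L_closed[OF hm] markov_orbit[OF hm]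
        linear_onD(1)[OF Ldot_linear hm] derivative[OF hm]]
    show "\<psi>m m n = \<pi> m (Ldot (n - 1) (hm m (n - 1)))" "\<psi>m m n \<in> zero_mass M Bs"
      by blast+
  qed
  have bounded_zero_mass: "\<phi> \<in> ?V" if zero: "\<And>n. \<phi> n \<in> zero_mass M Bs" and bdd: "bdd_above (range (\<lambda>n. ns (\<phi> n)))"
    for \<phi> :: "int \<Rightarrow> 'a set \<Rightarrow> real"
  proof -
    obtain c where "\<And>n. ns (\<phi> n) \<le> c"
      using bdd by (auto simp: bdd_above_def)
    moreover have "nw (\<phi> n) \<le> ns (\<phi> n)" for n
      using norm_le zero by (simp add: zero_mass_def)
    ultimately have "nw (\<phi> n) \<le> c" for n
      using order_trans by blast
    then show ?thesis
      by (rule limit.zero.ell_inftyI[rotated]) (use zero limit.zero_mass_subset in blast)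
  qed
  have \<psi>_V: "\<psi> \<in> ?V"
    using \<psi>_zero psi_bdd by (rule bounded_zero_mass)
  have \<psi>m_V: "\<psi>m m \<in> ?V" if "good m" for m
    using \<psi>m_zero[OF that] psi_m_bdd that by (intro bounded_zero_mass) (auto simp: good_def)

  have limit_invertible: "neumann_invertible ?V (sup_norm nw) (global_op (L 0))"
    using limit.compress_neumann_invertible by simp
  have invertible: "neumann_invertible ?V (sup_norm nw)
      (global_op (\<lambda>n. compress (\<pi> m) (L 0 n)))" if "good m" for m
    using contraction[OF that] by (rule compressed_contraction.compress_neumann_invertible)
  have inverse: "inverse_id_minus ?V T \<phi> \<in> ?V \<and> inverse_id_minus ?V T \<phi> - T (inverse_id_minus ?V T \<phi>) = \<phi>"
    if T: "neumann_invertible ?V (sup_norm nw) T" and \<phi>: "\<phi> \<in> ?V" for T \<phi>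
  proof -
    have bij: "bij_betw (\<lambda>x. x - T x) ?V ?V"
      using T by (simp add: neumann_invertible_def)
    then show ?thesis
      unfolding inverse_id_minus_def
      using \<phi> the_inv_into_into[of "\<lambda>x. x - T x" ?V \<phi> ?V] f_the_inv_into_f[of "\<lambda>x. x - T x" ?V \<phi>]
      by (auto simp: bij_betw_def)
  qed

  \<comment> \<open>The two responses and a strong bound on the uncompressed one\<close>
  define z where "z = inverse_id_minus ?V (global_op (L 0)) \<psi>"
  define zm where
    "zm m = inverse_id_minus ?V (global_op (\<lambda>n. compress (\<pi> m) (L 0 n))) (\<psi>m m)" for m
  have z: "z \<in> ?V" "z - global_op (L 0) z = \<psi>"
    using inverse[OF limit_invertible \<psi>_V] by (simp_all add: z_def)
  have zm: "zm m \<in> ?V" "zm m - global_op (\<lambda>n. compress (\<pi> m) (L 0 n)) (zm m) = \<psi>m m"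
    if "good m" for m
    using inverse[OF invertible \<psi>m_V] that by (simp_all add: zm_def)

  obtain H where H: "\<And>n. ns (h n) \<le> H"
    using base.h_bdd by (auto simp: bdd_above_def)
  obtain P where P: "\<And>n. ns (\<psi> n) \<le> P"
    using psi_bdd by (auto simp: bdd_above_def)
  \<comment> \<open>The equation for \<open>z\<close> writes each entry as an entry of
    \<open>\<psi>\<close> plus an image under \<open>L 0\<close>; regularization bounds the strong
    norm of that image by \<open>Creg\<close> times the weak norm of the previous entry.\<close>
  define Z where "Z = P + Creg * sup_norm nw z"
  have z_strong: "z n \<in> Bs" and z_bound: "ns (z n) \<le> Z" for n
  proof -
    have z_w: "z (n - 1) \<in> Bw"
      using limit.zero.ell_inftyD[OF z(1)] by (simp add: zero_mass_def)
    have z_n: "z n = \<psi> n + L 0 (n - 1) (z (n - 1))"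
      using z(2) by (auto simp: global_op_def)
    have \<psi>_n: "\<psi> n \<in> Bs"
      using \<psi>_zero by (simp add: zero_mass_def)
    show "z n \<in> Bs"
      unfolding z_n by (intro base.strong.add_closed \<psi>_n base.regular z_w)
    have "ns (z n) \<le> ns (\<psi> n) + ns (L 0 (n - 1) (z (n - 1)))"
      unfolding z_n by (intro base.strong.norm_triangle \<psi>_n base.regular z_w)
    also have "\<dots> \<le> P + Creg * nw (z (n - 1))"
      by (intro add_mono P base.regularization z_w)
    also have "\<dots> \<le> Z"
      unfolding Z_def using limit.zero.norm_le_sup_norm[OF z(1)] \<open>0 < Creg\<close> by simp
    finally show "ns (z n) \<le> Z" .
  qed

  \<comment> \<open>The outer factor is the resolvent constant. Inside, \<open>K\<close> times the
    bound of \<open>equivariant_diff\<close> estimates the difference of the derivative sequences,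
    and \<open>d * Z\<close> the projection error of \<open>z\<close>. The expression vanishes at
    \<open>d = 0\<close>, and \<open>k\<close> does not depend on \<open>m\<close>.\<close>
  define bound where "bound d = 2 * real (Suc k) *
    (K * (2 * real (Suc k) * (d * (Creg + 1) * H)) + d * Z)" for d
  have le_bound: "norm (sup_norm nw (zm m - global_proj (\<pi> m) z)) \<le> bound \<bar>\<delta> m\<bar>"
    if "good m" for m
  proof -
    interpret c: compressed_contraction Bs Bw ns nw M "L 0" h C0 \<gamma> Creg "\<pi> m" "\<bar>\<delta> m\<bar>" k
      using that by (rule contraction)
    have m: "1 \<le> m" using that by (simp add: good_def)
    have hm: "hm m n \<in> Bw" for n
      using equivariant_m[OF m] subset by (auto simp: equivariant_family_def prob_measures_def)
    have "nw (\<psi>m m n - \<pi> m (\<psi> n)) \<le> K * (2 * real (Suc k) * (\<bar>\<delta> m\<bar> * (Creg + 1) * H))" for n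
    proof -
      have h_diff: "hm m (n - 1) - h (n - 1) \<in> Bw"
        using hm base.h_weak by (rule weak.diff_closed)
      have D: "Ldot (n - 1) f \<in> Bw" if "f \<in> Bw" for f
        using Ldot_linear that by (rule linear_onD(1))
      have "\<psi>m m n - \<pi> m (\<psi> n) = \<pi> m (Ldot (n - 1) (hm m (n - 1) - h (n - 1)))"
        unfolding \<psi>m_eq[OF that] \<psi>_eq
        by (simp add: weak.linear_on_diff[OF Ldot_linear hm base.h_weak]
            weak.linear_on_diff[OF c.proj_linear D[OF hm] D[OF base.h_weak]])
      then have "nw (\<psi>m m n - \<pi> m (\<psi> n)) \<le> nw (Ldot (n - 1) (hm m (n - 1) - h (n - 1)))"
        using c.proj_weak_contraction[OF D[OF h_diff]] by simp
      also have "\<dots> \<le> K * nw (hm m (n - 1) - h (n - 1))"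
        using h_diff by (rule K)
      also have "\<dots> \<le> K * (2 * real (Suc k) * (\<bar>\<delta> m\<bar> * (Creg + 1) * H))"
        using K(1) c.equivariant_diff[OF equivariant_m[OF m] H] by (rule mult_left_mono[rotated])
      finally show ?thesis .
    qed
    note est = c.compress_response_diff[OF z(1) z_strong z_bound z(2) zm[OF that] this]
    have "0 \<le> sup_norm nw (zm m - global_proj (\<pi> m) z)"
      by (intro limit.zero.sup_norm_nonneg limit.seq.diff_closed zm(1) that est(1))
    with est(2) show ?thesis by (simp add: bound_def)
  qed
  have "(\<lambda>m. sup_norm nw (zm m - global_proj (\<pi> m) z)) \<longlonglongrightarrow> 0"
  proof (rule Lim_null_comparison)
    show "\<forall>\<^sub>F m in sequentially. norm (sup_norm nw (zm m - global_proj (\<pi> m) z)) \<le> bound \<bar>\<delta> m\<bar>"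
      using good by eventually_elim (rule le_bound)
    have "(\<lambda>m. bound \<bar>\<delta> m\<bar>) \<longlonglongrightarrow> bound 0"
      unfolding bound_def by (intro tendsto_intros \<delta>_abs)
    then show "(\<lambda>m. bound \<bar>\<delta> m\<bar>) \<longlonglongrightarrow> 0"
      by (simp add: bound_def)
  qed
  moreover have "\<forall>\<^sub>F m in sequentially. neumann_invertible ?V (sup_norm nw)
      (global_op (\<lambda>n. compress (\<pi> m) (L 0 n))) \<and> \<psi>m m \<in> ?V"
    using good by eventually_elim (simp add: invertible \<psi>m_V)
  ultimately show ?thesis
    using limit_invertible \<psi>_V by (simp add: Let_def z_def zm_def)
qed

end
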